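(* Let $\mathcal A$ be a locally small abelian category with enough projectives. An object of $\mathcal A$ is Gorenstein projective if and only if it has G-dimension zero. Equivalently, $\mathrm{GP}(\mathcal A)={}^{\perp}\mathcal P(\mathcal A)\cap\mathcal T^\infty(\mathcal A)$.
   Context: $\mathcal P(\mathcal A)$ is the full subcategory of projectives. A morphism $f:M\to P$ with $P$ projective is a left projective approximation if every morphism from $M$ to a projective object factors through $f$. For $n\ge1$, $M$ is $n$-torsionfree if there is an exact sequence $0\to M\xrightarrow{f_1}P_1\xrightarrow{f_2}\cdots\xrightarrow{f_n}P_n$ with all $P_i$ projective such that each inclusion $\mathrm{Im} f_i\to P_i$ is a left projective approximation ($1\le i\le n$); $\mathcal T^n(\mathcal A)$ is the full subcategory of such objects, and $\mathcal T^\infty(\mathcal A)=\bigcap_{n\ge1}\mathcal T^n(\mathcal A)$ is the subcategory of infinitely torsionfree ($\infty$-torsionfree) objects. Put ${}^{\perp}\mathcal P(\mathcal A)=\{X\in\mathcal A\mid \mathrm{Ext}^i_{\mathcal A}(X,P)=0\text{ for all }i\ge1,\ P\in\mathcal P(\mathcal A)\}$. An object $M$ has G-dimension zero if $\mathrm{Ext}^i_{\mathcal A}(M,P)=0$ for all $i>0$ and all projective $P$, and $M$ is $\infty$-torsionfree. An object $M$ is Gorenstein projective if it is isomorphic to the zeroth cocycle of a totally acyclic complex, i.e. of an acyclic complex of projectives, unbounded in both directions, that remains acyclic after applying $\mathrm{Hom}_{\mathcal A}(-,P)$ for every projective $P$; $\mathrm{GP}(\mathcal A)$ is the full subcategory of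 these objects. *)

theory Defs
  imports "HOL-Algebra.Elementary_Groups"
begin

section \<open>Categories\<close>

text \<open>
  Each collection \<open>Hom C X Y\<close> below is a HOL set, so local smallness is built into the encoding.
  Composition, identities and zero arrows are only constrained on their proper domains.
\<close>

record ('o, 'm) category =
  Obj :: "'o set"
  Arr :: "'m set"
  Dom :: "'m \<Rightarrow> 'o"
  Cod :: "'m \<Rightarrow> 'o"
  Ident :: "'o \<Rightarrow> 'm"
  Comp :: "'m \<Rightarrow> 'm \<Rightarrow> 'm"  (infixr "\<cdot>\<index>" 70)

definition Hom :: "('o, 'm, 'z) category_scheme \<Rightarrow> 'o \<Rightarrow> 'o \<Rightarrow> 'm set" where
  "Hom C X Y = {f \<in> Arr C. Dom C f = X \<and> Cod C f = Y}"

locale category =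
  fixes C :: "('o, 'm, 'z) category_scheme" (structure)
  assumes Dom_in_Obj: "f \<in> Arr C \<Longrightarrow> Dom C f \<in> Obj C"
    and Cod_in_Obj: "f \<in> Arr C \<Longrightarrow> Cod C f \<in> Obj C"
    and Ident_in_Hom: "X \<in> Obj C \<Longrightarrow> Ident C X \<in> Hom C X X"
    and Comp_in_Hom: "\<lbrakk>f \<in> Hom C X Y; g \<in> Hom C Y Z\<rbrakk> \<Longrightarrow> g \<cdot> f \<in> Hom C X Z"
    and Comp_Ident: "f \<in> Hom C X Y \<Longrightarrow> f \<cdot> Ident C X = f"
    and Ident_Comp: "f \<in> Hom C X Y \<Longrightarrow> Ident C Y \<cdot> f = f"
    and Comp_assoc: "\<lbrakk>f \<in> Hom C W X; g \<in> Hom C X Y; h \<in> Hom C Y Z\<rbrakk>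
          \<Longrightarrow> (h \<cdot> g) \<cdot> f = h \<cdot> (g \<cdot> f)"

definition is_mono :: "('o, 'm, 'z) category_scheme \<Rightarrow> 'm \<Rightarrow> bool" where
  "is_mono C f \<longleftrightarrow> f \<in> Arr C \<and>
     (\<forall>W. \<forall>g \<in> Hom C W (Dom C f). \<forall>h \<in> Hom C W (Dom C f).
        f \<cdot>\<^bsub>C\<^esub> g = f \<cdot>\<^bsub>C\<^esub> h \<longrightarrow> g = h)"

definition is_epi :: "('o, 'm, 'z) category_scheme \<Rightarrow> 'm \<Rightarrow> bool" where
  "is_epi C f \<longleftrightarrow> f \<in> Arr C \<and>
     (\<forall>W. \<forall>g \<in> Hom C (Cod C f) W. \<forall>h \<in> Hom C (Cod C f) W.
        g \<cdot>\<^bsub>C\<^esub> f = h \<cdot>\<^bsub>C\<^esub> f \<longrightarrow> g = h)"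

definition isomorphic :: "('o, 'm, 'z) category_scheme \<Rightarrow> 'o \<Rightarrow> 'o \<Rightarrow> bool" where
  "isomorphic C X Y \<longleftrightarrow> X \<in> Obj C \<and> Y \<in> Obj C \<and>
     (\<exists>f \<in> Hom C X Y. \<exists>g \<in> Hom C Y X.
        g \<cdot>\<^bsub>C\<^esub> f = Ident C X \<and> f \<cdot>\<^bsub>C\<^esub> g = Ident C Y)"

definition zero_object :: "('o, 'm, 'z) category_scheme \<Rightarrow> 'o \<Rightarrow> bool" where
  "zero_object C Z \<longleftrightarrow> Z \<in> Obj C \<and>
     (\<forall>X \<in> Obj C. (\<exists>!f. f \<in> Hom C Z X) \<and> (\<exists>!f. f \<in> Hom C X Z))"

definition Proj :: "('o, 'm, 'z) category_scheme \<Rightarrow> 'o set" where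
  "Proj C = {P \<in> Obj C. \<forall>e. is_epi C e \<longrightarrow>
     (\<forall>g \<in> Hom C P (Cod C e). \<exists>h \<in> Hom C P (Dom C e). e \<cdot>\<^bsub>C\<^esub> h = g)}"


section \<open>Abelian categories\<close>

record ('o, 'm) preadditive_category = "('o, 'm) category" +
  Add :: "'m \<Rightarrow> 'm \<Rightarrow> 'm"  (infixl "\<oplus>\<oplus>\<index>" 65)
  Zero :: "'o \<Rightarrow> 'o \<Rightarrow> 'm"

definition hom_group :: "('o, 'm, 'z) preadditive_category_scheme \<Rightarrow> 'o \<Rightarrow> 'o \<Rightarrow> 'm monoid" where
  "hom_group C X Y = \<lparr>carrier = Hom C X Y, mult = Add C, one = Zero C X Y\<rparr>"

locale preadditive_category = category C
  for C :: "('o, 'm, 'z) preadditive_category_scheme" (structure) +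
  assumes comm_group_hom_group: "\<lbrakk>X \<in> Obj C; Y \<in> Obj C\<rbrakk> \<Longrightarrow> comm_group (hom_group C X Y)"
    and Comp_Add: "\<lbrakk>f \<in> Hom C X Y; f' \<in> Hom C X Y; g \<in> Hom C Y Z\<rbrakk>
          \<Longrightarrow> g \<cdot> (f \<oplus>\<oplus> f') = (g \<cdot> f) \<oplus>\<oplus> (g \<cdot> f')"
    and Add_Comp: "\<lbrakk>f \<in> Hom C X Y; g \<in> Hom C Y Z; g' \<in> Hom C Y Z\<rbrakk>
          \<Longrightarrow> (g \<oplus>\<oplus> g') \<cdot> f = (g \<cdot> f) \<oplus>\<oplus> (g' \<cdot> f)"

definition is_kernel :: "('o, 'm, 'z) preadditive_category_scheme \<Rightarrow> 'm \<Rightarrow> 'm \<Rightarrow> bool" where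
  "is_kernel C f k \<longleftrightarrow> f \<in> Arr C \<and> k \<in> Arr C \<and> Cod C k = Dom C f \<and>
     f \<cdot>\<^bsub>C\<^esub> k = Zero C (Dom C k) (Cod C f) \<and>
     (\<forall>W. \<forall>h \<in> Hom C W (Dom C f). f \<cdot>\<^bsub>C\<^esub> h = Zero C W (Cod C f) \<longrightarrow>
        (\<exists>!u. u \<in> Hom C W (Dom C k) \<and> k \<cdot>\<^bsub>C\<^esub> u = h))"

definition is_cokernel :: "('o, 'm, 'z) preadditive_category_scheme \<Rightarrow> 'm \<Rightarrow> 'm \<Rightarrow> bool" where
  "is_cokernel C f c \<longleftrightarrow> f \<in> Arr C \<and> c \<in> Arr C \<and> Dom C c = Cod C f \<and>
     c \<cdot>\<^bsub>C\<^esub> f = Zero C (Dom C f) (Cod C c) \<and>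
     (\<forall>W. \<forall>h \<in> Hom C (Cod C f) W. h \<cdot>\<^bsub>C\<^esub> f = Zero C (Dom C f) W \<longrightarrow>
        (\<exists>!u. u \<in> Hom C (Cod C c) W \<and> u \<cdot>\<^bsub>C\<^esub> c = h))"

locale abelian_category = preadditive_category C
  for C :: "('o, 'm, 'z) preadditive_category_scheme" (structure) +
  assumes zero_object_exists: "\<exists>Z. zero_object C Z"
    and biproduct_exists: "\<lbrakk>X \<in> Obj C; Y \<in> Obj C\<rbrakk> \<Longrightarrow>
          \<exists>S. \<exists>i \<in> Hom C X S. \<exists>j \<in> Hom C Y S. \<exists>p \<in> Hom C S X. \<exists>q \<in> Hom C S Y.
            p \<cdot> i = Ident C X \<and> q \<cdot> j = Ident C Y \<and> (i \<cdot> p) \<oplus>\<oplus> (j \<cdot> q) = Ident C S"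
    and kernel_exists: "f \<in> Arr C \<Longrightarrow> \<exists>k. is_kernel C f k"
    and cokernel_exists: "f \<in> Arr C \<Longrightarrow> \<exists>c. is_cokernel C f c"
    and mono_is_kernel: "is_mono C f \<Longrightarrow> \<exists>g. is_kernel C g f"
    and epi_is_cokernel: "is_epi C f \<Longrightarrow> \<exists>g. is_cokernel C g f"

locale abelian_category_enough_projectives = abelian_category C
  for C :: "('o, 'm, 'z) preadditive_category_scheme" (structure) +
  assumes enough_projectives:
    "X \<in> Obj C \<Longrightarrow> \<exists>P \<in> Proj C. \<exists>e \<in> Hom C P X. is_epi C e"

text \<open>\<open>is_image C f m\<close>: the arrow \<open>m\<close> is (a representative of) the inclusion \<open>Im f \<rightarrow> Cod f\<close>.\<close>

definition is_image :: "('o, 'm, 'z) preadditive_category_scheme \<Rightarrow> 'm \<Rightarrow> 'm \<Rightarrow> bool" where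
  "is_image C f m \<longleftrightarrow> (\<exists>c. is_cokernel C f c \<and> is_kernel C c m)"

text \<open>Exactness of \<open>f\<close> followed by \<open>g\<close>: the subobjects \<open>Im f\<close> and \<open>Ker g\<close> coincide, i.e. they
  admit a common representative.\<close>

definition exact_pair :: "('o, 'm, 'z) preadditive_category_scheme \<Rightarrow> 'm \<Rightarrow> 'm \<Rightarrow> bool" where
  "exact_pair C f g \<longleftrightarrow> f \<in> Arr C \<and> g \<in> Arr C \<and> Cod C f = Dom C g \<and>
     (\<exists>m. is_image C f m \<and> is_kernel C g m)"


section \<open>Ext groups\<close>

text \<open>\<open>d 0\<close> is the augmentation \<open>Q 0 \<rightarrow> X\<close>.\<close>

definition projective_resolution ::
  "('o, 'm, 'z) preadditive_category_scheme \<Rightarrow> 'o \<Rightarrow> (nat \<Rightarrow> 'o) \<Rightarrow> (nat \<Rightarrow> 'm) \<Rightarrow> bool" where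
  "projective_resolution C X Q d \<longleftrightarrow>
     (\<forall>n. Q n \<in> Proj C) \<and> d 0 \<in> Hom C (Q 0) X \<and>
     (\<forall>n. d (Suc n) \<in> Hom C (Q (Suc n)) (Q n)) \<and>
     (\<exists>Z. zero_object C Z \<and> exact_pair C (d 0) (Zero C X Z)) \<and>
     (\<forall>n. exact_pair C (d (Suc n)) (d n))"

text \<open>Cohomology of \<open>Hom(Q 0, Y) \<rightarrow> Hom(Q 1, Y) \<rightarrow> \<dots>\<close>; the augmentation is not part of this
  complex, so in degree 0 nothing is divided out.\<close>

definition Ext_cocycles ::
  "('o, 'm, 'z) preadditive_category_scheme \<Rightarrow> (nat \<Rightarrow> 'o) \<Rightarrow> (nat \<Rightarrow> 'm) \<Rightarrow> nat \<Rightarrow> 'o \<Rightarrow> 'm set" where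
  "Ext_cocycles C Q d n Y =
     kernel (hom_group C (Q n) Y) (hom_group C (Q (Suc n)) Y) (\<lambda>g. g \<cdot>\<^bsub>C\<^esub> d (Suc n))"

fun Ext_coboundaries ::
  "('o, 'm, 'z) preadditive_category_scheme \<Rightarrow> (nat \<Rightarrow> 'o) \<Rightarrow> (nat \<Rightarrow> 'm) \<Rightarrow> nat \<Rightarrow> 'o \<Rightarrow> 'm set" where
  "Ext_coboundaries C Q d 0 Y = {Zero C (Q 0) Y}"
| "Ext_coboundaries C Q d (Suc n) Y = (\<lambda>g. g \<cdot>\<^bsub>C\<^esub> d (Suc n)) ` Hom C (Q n) Y"

definition Ext_via ::
  "('o, 'm, 'z) preadditive_category_scheme \<Rightarrow> (nat \<Rightarrow> 'o) \<Rightarrow> (nat \<Rightarrow> 'm) \<Rightarrow> nat \<Rightarrow> 'o \<Rightarrow> 'm set monoid" where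
  "Ext_via C Q d n Y =
     (hom_group C (Q n) Y)\<lparr>carrier := Ext_cocycles C Q d n Y\<rparr> Mod Ext_coboundaries C Q d n Y"

text \<open>As usual for a derived functor, \<open>Ext\<close> is computed from one arbitrarily chosen projective
  resolution of the first argument (one exists when there are enough projectives).\<close>

definition Ext ::
  "('o, 'm, 'z) preadditive_category_scheme \<Rightarrow> nat \<Rightarrow> 'o \<Rightarrow> 'o \<Rightarrow> 'm set monoid" where
  "Ext C n X Y = (case (SOME (Q, d). projective_resolution C X Q d) of (Q, d) \<Rightarrow> Ext_via C Q d n Y)"


section \<open>Torsionfree and Gorenstein projective objects\<close>

text \<open>Full subcategories are represented by their classes of objects.\<close>

definition left_projective_approximation ::
  "('o, 'm, 'z) category_scheme \<Rightarrow> 'm \<Rightarrow> bool" where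
  "left_projective_approximation C f \<longleftrightarrow> f \<in> Arr C \<and> Cod C f \<in> Proj C \<and>
     (\<forall>Q \<in> Proj C. \<forall>g \<in> Hom C (Dom C f) Q. \<exists>h \<in> Hom C (Cod C f) Q. h \<cdot>\<^bsub>C\<^esub> f = g)"

text \<open>The sequence \<open>0 \<rightarrow> M \<rightarrow> P 1 \<rightarrow> \<dots> \<rightarrow> P n\<close> has \<open>P 0 = M\<close> and \<open>f 0\<close> the arrow from a zero object;
  exactness is required at \<open>P 0, \<dots>, P (n - 1)\<close>, but not at \<open>P n\<close>. Meant for \<open>n \<ge> 1\<close>.\<close>

definition torsionfree :: "('o, 'm, 'z) preadditive_category_scheme \<Rightarrow> nat \<Rightarrow> 'o set" where
  "torsionfree C n = {M \<in> Obj C. \<exists>P f Z.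
     P 0 = M \<and> zero_object C Z \<and> f 0 = Zero C Z M \<and>
     (\<forall>i \<in> {1..n}. P i \<in> Proj C \<and> f i \<in> Hom C (P (i - 1)) (P i)) \<and>
     (\<forall>i < n. exact_pair C (f i) (f (Suc i))) \<and>
     (\<forall>i \<in> {1..n}. \<forall>m. is_image C (f i) m \<longrightarrow> left_projective_approximation C m)}"

definition infinitely_torsionfree :: "('o, 'm, 'z) preadditive_category_scheme \<Rightarrow> 'o set" where
  "infinitely_torsionfree C = (\<Inter>n \<in> {1..}. torsionfree C n)"

definition perp_Proj :: "('o, 'm, 'z) preadditive_category_scheme \<Rightarrow> 'o set" where
  "perp_Proj C = {X \<in> Obj C. \<forall>i \<ge> 1. \<forall>P \<in> Proj C. trivial_group (Ext C i X P)}"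

definition G_dimension_zero :: "('o, 'm, 'z) preadditive_category_scheme \<Rightarrow> 'o \<Rightarrow> bool" where
  "G_dimension_zero C M \<longleftrightarrow> M \<in> Obj C \<and>
     (\<forall>i > 0. \<forall>P \<in> Proj C. trivial_group (Ext C i M P)) \<and> M \<in> infinitely_torsionfree C"

definition acyclic_complex ::
  "('o, 'm, 'z) preadditive_category_scheme \<Rightarrow> (int \<Rightarrow> 'o) \<Rightarrow> (int \<Rightarrow> 'm) \<Rightarrow> bool" where
  "acyclic_complex C X d \<longleftrightarrow>
     (\<forall>i. X i \<in> Obj C \<and> d i \<in> Hom C (X i) (X (i + 1))) \<and>
     (\<forall>i. d (i + 1) \<cdot>\<^bsub>C\<^esub> d i = Zero C (X i) (X (i + 2))) \<and>
     (\<forall>i. exact_pair C (d i) (d (i + 1)))"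

definition totally_acyclic ::
  "('o, 'm, 'z) preadditive_category_scheme \<Rightarrow> (int \<Rightarrow> 'o) \<Rightarrow> (int \<Rightarrow> 'm) \<Rightarrow> bool" where
  "totally_acyclic C X d \<longleftrightarrow> acyclic_complex C X d \<and> (\<forall>i. X i \<in> Proj C) \<and>
     (\<forall>P \<in> Proj C. \<forall>i.
        (\<lambda>h. h \<cdot>\<^bsub>C\<^esub> d (i + 1)) ` carrier (hom_group C (X (i + 2)) P) =
        kernel (hom_group C (X (i + 1)) P) (hom_group C (X i) P) (\<lambda>g. g \<cdot>\<^bsub>C\<^esub> d i))"

definition Gorenstein_projective :: "('o, 'm, 'z) preadditive_category_scheme \<Rightarrow> 'o \<Rightarrow> bool" where
  "Gorenstein_projective C M \<longleftrightarrow>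
     (\<exists>X d k. totally_acyclic C X d \<and> is_kernel C (d 0) k \<and> isomorphic C M (Dom C k))"

definition GP :: "('o, 'm, 'z) preadditive_category_scheme \<Rightarrow> 'o set" where
  "GP C = {M \<in> Obj C. Gorenstein_projective C M}"

end

(*
  Exactness of a pair of arrows is tested by Hom(W, -) for projective W. This makes "exact" and "exact
  after applying Hom(-, Q) for projective Q" mirror images of each other, exchanged by passing to the
  opposite category. Two coresolutions 0 -> M -> P 1 -> P 2 -> ... by projectives that are exact under
  every Hom(-, Q) are compared by maps that compose to the identity up to homotopy. Read forwards, this
  shows that exactness passes from one such coresolution to another, so that the n-step sequences for all
  n can be replaced by a single infinite one. Read in the opposite category, it shows that the vanishing
  of Ext does not depend on the projective resolution. Splicing a projective resolution of M with its
  infinite coresolution at Q 0 -> M -> P 1 gives a totally acyclic complex; conversely such a complex is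
  cut at M by factoring one differential as an epimorphism followed by a monomorphism.
*)
theory Submission
  imports Defs
begin

section \<open>Exactness tested by Hom functors\<close>

text \<open>The obstacle: membership in every T^n gives, for each n, some sequence of length n, and
  these sequences need not extend one another. A sequence ending in \<open>a\<close> cannot borrow
  the next arrow \<open>b'\<close> of a longer one, because \<open>b'\<close> starts at a different
  projective. Pulling \<open>b'\<close> back along a comparison map \<phi> is not enough either: if
  g vanishes on \<open>a\<close>, then \<open>b' \<phi>\<close> only controls g \<psi> \<phi>, not
  g. The difference between the two is governed by the homotopy error \<psi> \<phi> - 1 - a s, so
  this error is adjoined as a second component of the new arrow, at the price of enlarging its
  target to a biproduct. The prolongation is controlled only under Hom(-, Q); ordinary exactness is
  recovered afterwards, one position at a time, from the finite sequences that were given.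

  The comparison itself uses no kernels or images, only composition and addition of arrows. It
  therefore lives in preadditive categories, where passing to the opposite category costs
  nothing.\<close>

definition exact_from ::
  "('o, 'm, 'z) preadditive_category_scheme \<Rightarrow> 'o set \<Rightarrow> 'm \<Rightarrow> 'm \<Rightarrow> bool" where
  "exact_from C S a b \<longleftrightarrow> a \<in> Arr C \<and> b \<in> Arr C \<and> Cod C a = Dom C b \<and>
     b \<cdot>\<^bsub>C\<^esub> a = Zero C (Dom C a) (Cod C b) \<and>
     (\<forall>W \<in> S. \<forall>g \<in> Hom C W (Dom C b). b \<cdot>\<^bsub>C\<^esub> g = Zero C W (Cod C b) \<longrightarrow>
        (\<exists>h \<in> Hom C W (Dom C a). a \<cdot>\<^bsub>C\<^esub> h = g))"

text \<open>The test class \<open>S\<close> is a parameter for two reasons. Duality turns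
  projectives into injectives, so in the opposite category \<open>Proj C\<close> must survive as a
  mere set of objects; and Ext into a single object is tested with a singleton class.\<close>

definition exact_into ::
  "('o, 'm, 'z) preadditive_category_scheme \<Rightarrow> 'o set \<Rightarrow> 'm \<Rightarrow> 'm \<Rightarrow> bool" where
  "exact_into C S a b \<longleftrightarrow> a \<in> Arr C \<and> b \<in> Arr C \<and> Cod C a = Dom C b \<and>
     b \<cdot>\<^bsub>C\<^esub> a = Zero C (Dom C a) (Cod C b) \<and>
     (\<forall>Q \<in> S. \<forall>g \<in> Hom C (Cod C a) Q. g \<cdot>\<^bsub>C\<^esub> a = Zero C (Dom C a) Q \<longrightarrow>
        (\<exists>h \<in> Hom C (Cod C b) Q. h \<cdot>\<^bsub>C\<^esub> b = g))"

section \<open>Calculus of arrows and hom groups\<close>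

context category
begin

text \<open>Membership in \<open>Hom\<close> is broken into equations for \<open>Arr\<close>,
  \<open>Dom\<close> and \<open>Cod\<close>, so that the simplifier can check composability. This is
  why later proofs begin by collecting such equations.\<close>

lemma Dom_Obj [simp]: "f \<in> Arr C \<Longrightarrow> Dom C f \<in> Obj C"
  and Cod_Obj [simp]: "f \<in> Arr C \<Longrightarrow> Cod C f \<in> Obj C"
  by (rule Dom_in_Obj Cod_in_Obj; assumption)+

lemma Ident_simps [simp]:
  assumes "X \<in> Obj C"
  shows "Ident C X \<in> Arr C" "Dom C (Ident C X) = X" "Cod C (Ident C X) = X"
  using Ident_in_Hom [OF assms] by (auto simp: Hom_def)

lemma Comp_simps [simp]:
  assumes "f \<in> Arr C" "g \<in> Arr C" "Cod C f = Dom C g"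
  shows "g \<cdot> f \<in> Arr C" "Dom C (g \<cdot> f) = Dom C f" "Cod C (g \<cdot> f) = Cod C g"
  using Comp_in_Hom [of f "Dom C f" "Cod C f" g "Cod C g"] assms by (auto simp: Hom_def)

lemma Comp_Ident_simps [simp]:
  assumes "f \<in> Arr C"
  shows "Dom C f = X \<Longrightarrow> f \<cdot> Ident C X = f" "Cod C f = Y \<Longrightarrow> Ident C Y \<cdot> f = f"
  using Comp_Ident [of f "Dom C f" "Cod C f"] Ident_Comp [of f "Dom C f" "Cod C f"] assms
  by (auto simp: Hom_def)

lemma Comp_assoc_Arr:
  assumes "f \<in> Arr C" "g \<in> Arr C" "h \<in> Arr C" "Cod C f = Dom C g" "Cod C g = Dom C h"
  shows "(h \<cdot> g) \<cdot> f = h \<cdot> (g \<cdot> f)"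
  using Comp_assoc [of f "Dom C f" "Cod C f" g "Cod C g" h "Cod C h"] assms by (auto simp: Hom_def)

lemma is_mono_cancel:
  assumes "is_mono C m" "f \<in> Hom C W (Dom C m)" "g \<in> Hom C W (Dom C m)" "m \<cdot> f = m \<cdot> g"
  shows "f = g"
  using assms by (auto simp: is_mono_def)

lemma is_epi_cancel:
  assumes "is_epi C e" "f \<in> Hom C (Cod C e) W" "g \<in> Hom C (Cod C e) W" "f \<cdot> e = g \<cdot> e"
  shows "f = g"
  using assms by (auto simp: is_epi_def)

lemma Proj_Obj: "P \<in> Proj C \<Longrightarrow> P \<in> Obj C"
  by (simp add: Proj_def)

lemma Proj_lift:
  assumes "P \<in> Proj C" "is_epi C e" "g \<in> Hom C P (Cod C e)"
  obtains h where "h \<in> Hom C P (Dom C e)" "e \<cdot> h = g"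
  using assms by (auto simp: Proj_def)

end

context preadditive_category
begin

lemma Add_simps [simp]:
  assumes "f \<in> Arr C" "g \<in> Arr C" "Dom C f = Dom C g" "Cod C f = Cod C g"
  shows "f \<oplus>\<oplus> g \<in> Arr C" "Dom C (f \<oplus>\<oplus> g) = Dom C g" "Cod C (f \<oplus>\<oplus> g) = Cod C g"
proof -
  interpret G: comm_group "hom_group C (Dom C g) (Cod C g)"
    using assms by (intro comm_group_hom_group) auto
  have "f \<oplus>\<oplus> g \<in> Hom C (Dom C g) (Cod C g)"
    using G.m_closed [of f g] assms by (simp add: hom_group_def Hom_def)
  then show "f \<oplus>\<oplus> g \<in> Arr C" "Dom C (f \<oplus>\<oplus> g) = Dom C g" "Cod C (f \<oplus>\<oplus> g) = Cod C g"
    by (auto simp: Hom_def)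
qed

lemma Zero_simps [simp]:
  assumes "X \<in> Obj C" "Y \<in> Obj C"
  shows "Zero C X Y \<in> Arr C" "Dom C (Zero C X Y) = X" "Cod C (Zero C X Y) = Y"
proof -
  interpret G: comm_group "hom_group C X Y"
    using assms by (intro comm_group_hom_group) auto
  have "Zero C X Y \<in> Hom C X Y"
    using G.one_closed by (simp add: hom_group_def)
  then show "Zero C X Y \<in> Arr C" "Dom C (Zero C X Y) = X" "Cod C (Zero C X Y) = Y"
    by (auto simp: Hom_def)
qed

lemma Add_Zero_simps [simp]:
  assumes "f \<in> Arr C" "Dom C f = X" "Cod C f = Y"
  shows "f \<oplus>\<oplus> Zero C X Y = f" "Zero C X Y \<oplus>\<oplus> f = f"
proof -
  interpret G: comm_group "hom_group C X Y"
    using assms by (intro comm_group_hom_group) auto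
  show "f \<oplus>\<oplus> Zero C X Y = f" "Zero C X Y \<oplus>\<oplus> f = f"
    using G.r_one [of f] G.l_one [of f] assms by (simp_all add: hom_group_def Hom_def)
qed

lemma Add_assoc:
  assumes "f \<in> Hom C X Y" "g \<in> Hom C X Y" "h \<in> Hom C X Y"
  shows "(f \<oplus>\<oplus> g) \<oplus>\<oplus> h = f \<oplus>\<oplus> (g \<oplus>\<oplus> h)"
proof -
  interpret G: comm_group "hom_group C X Y"
    using assms by (intro comm_group_hom_group) (auto simp: Hom_def)
  show ?thesis
    using G.m_assoc [of f g h] assms by (simp add: hom_group_def)
qed

lemma Add_commute:
  assumes "f \<in> Hom C X Y" "g \<in> Hom C X Y"
  shows "f \<oplus>\<oplus> g = g \<oplus>\<oplus> f"
proof -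
  interpret G: comm_group "hom_group C X Y"
    using assms by (intro comm_group_hom_group) (auto simp: Hom_def)
  show ?thesis
    using G.m_comm [of f g] assms by (simp add: hom_group_def)
qed

lemma Add_cancel:
  assumes "f \<in> Hom C X Y" "g \<in> Hom C X Y" "h \<in> Hom C X Y" "f \<oplus>\<oplus> h = g \<oplus>\<oplus> h"
  shows "f = g"
proof -
  interpret G: comm_group "hom_group C X Y"
    using assms by (intro comm_group_hom_group) (auto simp: Hom_def)
  show ?thesis
    using G.right_cancel [of h f g] assms by (simp add: hom_group_def)
qed

lemma Add_inverse:
  assumes "f \<in> Hom C X Y"
  obtains n where "n \<in> Hom C X Y" "f \<oplus>\<oplus> n = Zero C X Y" "n \<oplus>\<oplus> f = Zero C X Y"
proof -
  interpret G: comm_group "hom_group C X Y"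
    using assms by (intro comm_group_hom_group) (auto simp: Hom_def)
  show ?thesis
    using that [of "inv\<^bsub>hom_group C X Y\<^esub> f"] G.r_inv [of f] G.l_inv [of f] G.inv_closed [of f] assms
    by (simp add: hom_group_def)
qed

lemma Comp_Add_Arr:
  assumes "f \<in> Arr C" "f' \<in> Arr C" "g \<in> Arr C"
    and "Dom C f = Dom C f'" "Cod C f = Dom C g" "Cod C f' = Dom C g"
  shows "g \<cdot> (f \<oplus>\<oplus> f') = (g \<cdot> f) \<oplus>\<oplus> (g \<cdot> f')"
  using Comp_Add [of f "Dom C f'" "Dom C g" f' g "Cod C g"] assms by (simp add: Hom_def)

lemma Add_Comp_Arr:
  assumes "f \<in> Arr C" "g \<in> Arr C" "g' \<in> Arr C"
    and "Cod C g = Cod C g'" "Cod C f = Dom C g" "Cod C f = Dom C g'"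
  shows "(g \<oplus>\<oplus> g') \<cdot> f = (g \<cdot> f) \<oplus>\<oplus> (g' \<cdot> f)"
  using Add_Comp [of f "Dom C f" "Cod C f" g "Cod C g'" g'] assms by (simp add: Hom_def)

lemma Comp_Zero_simps [simp]:
  assumes "g \<in> Arr C" "X \<in> Obj C"
  shows "Dom C g = Y \<Longrightarrow> g \<cdot> Zero C X Y = Zero C X (Cod C g)"
    and "Cod C g = Y \<Longrightarrow> Zero C Y X \<cdot> g = Zero C (Dom C g) X"
proof -
  have "g \<cdot> Zero C X (Dom C g) = (g \<cdot> Zero C X (Dom C g)) \<oplus>\<oplus> (g \<cdot> Zero C X (Dom C g))"
    using Comp_Add_Arr [of "Zero C X (Dom C g)" "Zero C X (Dom C g)" g] assms by simp
  then have "g \<cdot> Zero C X (Dom C g) = Zero C X (Cod C g)"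
    using Add_cancel [of "Zero C X (Cod C g)" X "Cod C g"
        "g \<cdot> Zero C X (Dom C g)" "g \<cdot> Zero C X (Dom C g)"] assms
    by (simp add: Hom_def)
  then show "Dom C g = Y \<Longrightarrow> g \<cdot> Zero C X Y = Zero C X (Cod C g)"
    by auto
  have "Zero C (Cod C g) X \<cdot> g = (Zero C (Cod C g) X \<cdot> g) \<oplus>\<oplus> (Zero C (Cod C g) X \<cdot> g)"
    using Add_Comp_Arr [of g "Zero C (Cod C g) X" "Zero C (Cod C g) X"] assms by simp
  then have "Zero C (Cod C g) X \<cdot> g = Zero C (Dom C g) X"
    using Add_cancel [of "Zero C (Dom C g) X" "Dom C g" X
        "Zero C (Cod C g) X \<cdot> g" "Zero C (Cod C g) X \<cdot> g"] assms
    by (simp add: Hom_def)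
  then show "Cod C g = Y \<Longrightarrow> Zero C Y X \<cdot> g = Zero C (Dom C g) X"
    by auto
qed

text \<open>The difference of \<open>g\<close> and \<open>g'\<close> vanishes on \<open>a\<close>
  and hence factors through \<open>b\<close>. All new homotopy components that are not zero arise in
  this way.\<close>

lemma exact_into_diff:
  assumes "exact_into C S a b" "Q \<in> S" "g \<in> Hom C (Cod C a) Q" "g' \<in> Hom C (Cod C a) Q"
    and eq: "g \<cdot> a = g' \<cdot> a"
  obtains h where "h \<in> Hom C (Cod C b) Q" "g = g' \<oplus>\<oplus> (h \<cdot> b)"
proof -
  have ab: "a \<in> Arr C" "b \<in> Arr C" "Cod C a = Dom C b"
    using assms(1) by (auto simp: exact_into_def)
  have gg: "g \<in> Arr C" "Dom C g = Dom C b" "Cod C g = Q" "g' \<in> Arr C" "Dom C g' = Dom C b" "Cod C g' = Q"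
    "Q \<in> Obj C"
    using assms ab by (auto simp: Hom_def)
  \<comment> \<open>The record has no subtraction; here and below a difference is a sum with an
    additive inverse, in this case \<open>n\<close> = -g'.\<close>
  obtain n where n: "n \<in> Hom C (Cod C a) Q" "g' \<oplus>\<oplus> n = Zero C (Cod C a) Q"
    using Add_inverse [OF assms(4)] by metis
  have n': "n \<in> Arr C" "Dom C n = Dom C b" "Cod C n = Q"
    using n(1) ab by (auto simp: Hom_def)
  have "(n \<oplus>\<oplus> g) \<cdot> a = (n \<cdot> a) \<oplus>\<oplus> (g' \<cdot> a)"
    using ab gg n' eq by (simp add: Add_Comp_Arr)
  also have "\<dots> = (g' \<cdot> a) \<oplus>\<oplus> (n \<cdot> a)"
    by (rule Add_commute [of _ "Dom C a" Q]) (use ab gg n' in \<open>auto simp: Hom_def\<close>)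
  also have "\<dots> = (g' \<oplus>\<oplus> n) \<cdot> a"
    using ab gg n' by (simp add: Add_Comp_Arr)
  also have "\<dots> = Zero C (Dom C a) Q"
    using ab gg n by simp
  finally have "(n \<oplus>\<oplus> g) \<cdot> a = Zero C (Dom C a) Q" .
  moreover have "n \<oplus>\<oplus> g \<in> Hom C (Cod C a) Q"
    using ab gg n' by (simp add: Hom_def)
  ultimately obtain h where h: "h \<in> Hom C (Cod C b) Q" "h \<cdot> b = n \<oplus>\<oplus> g"
    using assms(1,2) unfolding exact_into_def by meson
  have "g' \<oplus>\<oplus> (h \<cdot> b) = (g' \<oplus>\<oplus> n) \<oplus>\<oplus> g"
    using Add_assoc [of g' "Cod C a" Q n g] assms n(1) h(2) by simp
  also have "\<dots> = g"
    using n gg ab by simp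
  finally show ?thesis
    using that h by simp
qed

end

section \<open>The opposite category\<close>

text \<open>A record update keeps the type of \<open>C\<close>, so the locale
  \<open>preadditive_category\<close> can be interpreted at the opposite category and every lemma
  proved in it is available in dual form.\<close>

definition opposite ::
  "('o, 'm, 'z) preadditive_category_scheme \<Rightarrow> ('o, 'm, 'z) preadditive_category_scheme" where
  "opposite C = C\<lparr>Dom := Cod C, Cod := Dom C, Comp := \<lambda>g f. f \<cdot>\<^bsub>C\<^esub> g, Zero := \<lambda>X Y. Zero C Y X\<rparr>"

lemma opposite_simps [simp]:
  "Obj (opposite C) = Obj C" "Arr (opposite C) = Arr C"
  "Dom (opposite C) = Cod C" "Cod (opposite C) = Dom C" "Ident (opposite C) = Ident C"
  "g \<cdot>\<^bsub>opposite C\<^esub> f = f \<cdot>\<^bsub>C\<^esub> g" "Add (opposite C) = Add C"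
  "Zero (opposite C) X Y = Zero C Y X"
  by (simp_all add: opposite_def)

lemma Hom_opposite [simp]: "Hom (opposite C) X Y = Hom C Y X"
  by (auto simp: Hom_def)

lemma exact_opposite:
  "exact_into (opposite C) S b a = exact_from C S a b"
  "exact_from (opposite C) S b a = exact_into C S a b"
  by (auto simp: exact_into_def exact_from_def)

lemma is_epi_opposite: "is_epi (opposite C) f = is_mono C f"
  by (simp add: is_epi_def is_mono_def)

lemma (in preadditive_category) preadditive_category_opposite:
  "preadditive_category (opposite C)"
proof (intro preadditive_category.intro category.intro preadditive_category_axioms.intro)
  fix X Y assume "X \<in> Obj (opposite C)" "Y \<in> Obj (opposite C)"
  then show "comm_group (hom_group (opposite C) X Y)"
    using comm_group_hom_group [of Y X] by (simp add: hom_group_def)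
qed (auto simp: Ident_in_Hom Comp_in_Hom Comp_Ident Ident_Comp Comp_assoc Comp_Add Add_Comp)

section \<open>Comparison of coresolutions\<close>

text \<open>\<open>\<psi> \<phi>\<close> is homotopic to the identity, but the homotopy is recorded only up to its next component
  \<open>s'\<close>: the difference \<open>\<psi> \<phi> - 1 - a s\<close> is only required to vanish on the image of \<open>a\<close>, which
  produces \<open>s'\<close> as soon as the target of \<open>a\<close> lies in \<open>S\<close>.\<close>

definition comparison ::
  "('o, 'm, 'z) preadditive_category_scheme \<Rightarrow> 'm \<Rightarrow> 'm \<Rightarrow> 'm \<Rightarrow> 'm \<Rightarrow> 'm \<Rightarrow> bool" where
  "comparison C a a' \<phi> \<psi> s \<longleftrightarrow>
     \<phi> \<in> Hom C (Cod C a) (Cod C a') \<and> \<psi> \<in> Hom C (Cod C a') (Cod C a) \<and>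
     s \<in> Hom C (Cod C a) (Dom C a) \<and>
     (\<exists>x \<in> Hom C (Dom C a) (Dom C a'). \<phi> \<cdot>\<^bsub>C\<^esub> a = a' \<cdot>\<^bsub>C\<^esub> x) \<and>
     (\<exists>y \<in> Hom C (Dom C a') (Dom C a). \<psi> \<cdot>\<^bsub>C\<^esub> a' = a \<cdot>\<^bsub>C\<^esub> y) \<and>
     (\<psi> \<cdot>\<^bsub>C\<^esub> \<phi>) \<cdot>\<^bsub>C\<^esub> a = (Ident C (Cod C a) \<oplus>\<oplus>\<^bsub>C\<^esub> (a \<cdot>\<^bsub>C\<^esub> s)) \<cdot>\<^bsub>C\<^esub> a"

context preadditive_category
begin

lemma exact_intoD:
  assumes "exact_into C S a b"
  shows "a \<in> Arr C" "b \<in> Arr C" "Cod C a = Dom C b" "b \<cdot> a = Zero C (Dom C a) (Cod C b)"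
    and "\<lbrakk>Q \<in> S; g \<in> Hom C (Cod C a) Q; g \<cdot> a = Zero C (Dom C a) Q\<rbrakk>
      \<Longrightarrow> \<exists>h \<in> Hom C (Cod C b) Q. h \<cdot> b = g"
  using assms by (auto simp: exact_into_def)

lemma exact_fromD:
  assumes "exact_from C S a b"
  shows "a \<in> Arr C" "b \<in> Arr C" "Cod C a = Dom C b" "b \<cdot> a = Zero C (Dom C a) (Cod C b)"
    and "\<lbrakk>W \<in> S; g \<in> Hom C W (Dom C b); b \<cdot> g = Zero C W (Cod C b)\<rbrakk>
      \<Longrightarrow> \<exists>h \<in> Hom C W (Dom C a). a \<cdot> h = g"
  using assms by (auto simp: exact_from_def)

text \<open>The next components exist because \<open>b' \<phi>\<close> vanishes on \<open>a\<close>
  and \<open>b \<psi>\<close> vanishes on \<open>a'\<close>, by the commuting squares with x and y.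
  The disjunction \<open>eq\<close> handles the start: the first target \<open>M\<close> may lie
  outside \<open>S\<close>, so exactness cannot produce a homotopy there, but there the relation
  holds on the nose and \<open>s'\<close> = 0 serves.\<close>

lemma comparison_step:
  assumes cmp: "comparison C a a' \<phi> \<psi> s"
    and ab: "exact_into C S a b" and ab': "exact_into C S a' b'"
    and S: "Cod C b \<in> S" "Cod C b' \<in> S"
    and eq: "Cod C a \<in> S \<or> \<psi> \<cdot> \<phi> = Ident C (Cod C a) \<oplus>\<oplus> (a \<cdot> s)"
  obtains \<phi>' \<psi>' s' where "comparison C b b' \<phi>' \<psi>' s'" "\<phi>' \<cdot> b = b' \<cdot> \<phi>"
    and "\<psi> \<cdot> \<phi> = (Ident C (Cod C a) \<oplus>\<oplus> (a \<cdot> s)) \<oplus>\<oplus> (s' \<cdot> b)"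
proof -
  note A = exact_intoD(1-4) [OF ab] and A' = exact_intoD(1-4) [OF ab']
  obtain x y where x: "x \<in> Hom C (Dom C a) (Dom C a')" "\<phi> \<cdot> a = a' \<cdot> x"
    and y: "y \<in> Hom C (Dom C a') (Dom C a)" "\<psi> \<cdot> a' = a \<cdot> y"
    and com: "(\<psi> \<cdot> \<phi>) \<cdot> a = (Ident C (Cod C a) \<oplus>\<oplus> (a \<cdot> s)) \<cdot> a"
    using cmp by (auto simp: comparison_def)
  have H [simp]: "\<phi> \<in> Arr C" "Dom C \<phi> = Dom C b" "Cod C \<phi> = Dom C b'"
    "\<psi> \<in> Arr C" "Dom C \<psi> = Dom C b'" "Cod C \<psi> = Dom C b"
    "s \<in> Arr C" "Dom C s = Dom C b" "Cod C s = Dom C a"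
    "x \<in> Arr C" "Dom C x = Dom C a" "Cod C x = Dom C a'"
    "y \<in> Arr C" "Dom C y = Dom C a'" "Cod C y = Dom C a"
    "a \<in> Arr C" "b \<in> Arr C" "Cod C a = Dom C b"
    "a' \<in> Arr C" "b' \<in> Arr C" "Cod C a' = Dom C b'"
    using cmp x y A A' by (auto simp: comparison_def Hom_def)
  have "(b' \<cdot> \<phi>) \<cdot> a = (b' \<cdot> a') \<cdot> x"
    using x(2) by (simp add: Comp_assoc_Arr)
  then have "(b' \<cdot> \<phi>) \<cdot> a = Zero C (Dom C a) (Cod C b')"
    using A' by simp
  then obtain \<phi>' where \<phi>': "\<phi>' \<in> Hom C (Cod C b) (Cod C b')" "\<phi>' \<cdot> b = b' \<cdot> \<phi>"
    using exact_intoD(5) [OF ab S(2), of "b' \<cdot> \<phi>"] by (auto simp: Hom_def)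
  have "(b \<cdot> \<psi>) \<cdot> a' = (b \<cdot> a) \<cdot> y"
    using y(2) by (simp add: Comp_assoc_Arr)
  then have "(b \<cdot> \<psi>) \<cdot> a' = Zero C (Dom C a') (Cod C b)"
    using A by simp
  then obtain \<psi>' where \<psi>': "\<psi>' \<in> Hom C (Cod C b') (Cod C b)" "\<psi>' \<cdot> b' = b \<cdot> \<psi>"
    using exact_intoD(5) [OF ab' S(1), of "b \<cdot> \<psi>"] by (auto simp: Hom_def)
  obtain s' where s': "s' \<in> Hom C (Cod C b) (Cod C a)"
    "\<psi> \<cdot> \<phi> = (Ident C (Cod C a) \<oplus>\<oplus> (a \<cdot> s)) \<oplus>\<oplus> (s' \<cdot> b)"
  proof (cases "Cod C a \<in> S")
    case True
    show ?thesis
      by (rule exact_into_diff [OF ab True _ _ com]) (auto simp: Hom_def intro: that)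
  next
    case False
    then have "\<psi> \<cdot> \<phi> = Ident C (Cod C a) \<oplus>\<oplus> (a \<cdot> s)"
      using eq by simp
    then show ?thesis
      by (intro that [of "Zero C (Cod C b) (Cod C a)"]) (auto simp: Hom_def)
  qed
  have H' [simp]: "\<phi>' \<in> Arr C" "Dom C \<phi>' = Cod C b" "Cod C \<phi>' = Cod C b'"
    "\<psi>' \<in> Arr C" "Dom C \<psi>' = Cod C b'" "Cod C \<psi>' = Cod C b"
    "s' \<in> Arr C" "Dom C s' = Cod C b" "Cod C s' = Dom C b"
    using \<phi>' \<psi>' s' by (auto simp: Hom_def)
  have bas: "b \<cdot> (a \<cdot> s) = Zero C (Dom C b) (Cod C b)"
    using A Comp_assoc_Arr [of s a b] by simp
  have "(\<psi>' \<cdot> \<phi>') \<cdot> b = (\<psi>' \<cdot> b') \<cdot> \<phi>"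
    using \<phi>'(2) by (simp add: Comp_assoc_Arr)
  also have "\<dots> = b \<cdot> (\<psi> \<cdot> \<phi>)"
    using \<psi>'(2) by (simp add: Comp_assoc_Arr)
  \<comment> \<open>Composing 1 + a s + s' b with \<open>b\<close> removes the old homotopy term,
    since b a = 0; what is left is the comparison condition one step further with homotopy
    \<open>s'\<close>.\<close>
  also have "\<dots> = b \<oplus>\<oplus> (b \<cdot> (s' \<cdot> b))"
    unfolding s'(2) using bas by (simp add: Comp_Add_Arr)
  also have "\<dots> = (Ident C (Cod C b) \<oplus>\<oplus> (b \<cdot> s')) \<cdot> b"
    by (simp add: Add_Comp_Arr Comp_assoc_Arr)
  finally have "(\<psi>' \<cdot> \<phi>') \<cdot> b = (Ident C (Cod C b) \<oplus>\<oplus> (b \<cdot> s')) \<cdot> b" .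
  moreover have "\<phi> \<in> Hom C (Dom C b) (Dom C b')" "\<psi> \<in> Hom C (Dom C b') (Dom C b)"
    by (simp_all add: Hom_def)
  ultimately have "comparison C b b' \<phi>' \<psi>' s'"
    unfolding comparison_def using \<phi>' \<psi>' s'(1) by auto
  then show ?thesis
    using that \<phi>'(2) s'(2) by blast
qed

text \<open>The homology of the unprimed sequence is a retract of that of the primed one, so the
  single relation between \<psi> \<phi> and the identity suffices. The class \<open>T\<close> is
  unrelated to \<open>S\<close>.\<close>

lemma comparison_exact_from:
  assumes cmp: "comparison C a a' \<phi> \<psi> s"
    and ab: "exact_into C S a b" and ab': "exact_into C S a' b'"
    and S: "Cod C b \<in> S" "Cod C b' \<in> S"
    and eq: "Cod C a \<in> S \<or> \<psi> \<cdot> \<phi> = Ident C (Cod C a) \<oplus>\<oplus> (a \<cdot> s)"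
    and ex: "exact_from C T a' b'"
  shows "exact_from C T a b"
proof -
  obtain \<phi>' \<psi>' s' where cmp': "comparison C b b' \<phi>' \<psi>' s'" and \<phi>': "\<phi>' \<cdot> b = b' \<cdot> \<phi>"
    and s': "\<psi> \<cdot> \<phi> = (Ident C (Cod C a) \<oplus>\<oplus> (a \<cdot> s)) \<oplus>\<oplus> (s' \<cdot> b)"
    using comparison_step [OF assms(1-6)] by metis
  note A = exact_intoD(1-4) [OF ab] and A' = exact_intoD(1-4) [OF ab']
  obtain y where y: "y \<in> Hom C (Dom C a') (Dom C a)" "\<psi> \<cdot> a' = a \<cdot> y"
    using cmp by (auto simp: comparison_def)
  have H [simp]: "\<phi> \<in> Arr C" "Dom C \<phi> = Dom C b" "Cod C \<phi> = Dom C b'"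
    "\<psi> \<in> Arr C" "Dom C \<psi> = Dom C b'" "Cod C \<psi> = Dom C b"
    "s \<in> Arr C" "Dom C s = Dom C b" "Cod C s = Dom C a"
    "y \<in> Arr C" "Dom C y = Dom C a'" "Cod C y = Dom C a"
    "a \<in> Arr C" "b \<in> Arr C" "Cod C a = Dom C b"
    "a' \<in> Arr C" "b' \<in> Arr C" "Cod C a' = Dom C b'"
    "\<phi>' \<in> Arr C" "Dom C \<phi>' = Cod C b" "Cod C \<phi>' = Cod C b'"
    "s' \<in> Arr C" "Dom C s' = Cod C b" "Cod C s' = Dom C b"
    using cmp cmp' y A A' by (auto simp: comparison_def Hom_def)
  have "\<exists>h \<in> Hom C W (Dom C a). a \<cdot> h = g"
    if W: "W \<in> T" and g: "g \<in> Hom C W (Dom C b)" and bg: "b \<cdot> g = Zero C W (Cod C b)" for W g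
  proof -
    have [simp]: "g \<in> Arr C" "Dom C g = W" "Cod C g = Dom C b" "W \<in> Obj C"
      using g by (auto simp: Hom_def)
    have "b' \<cdot> (\<phi> \<cdot> g) = \<phi>' \<cdot> (b \<cdot> g)"
      using \<phi>' by (simp add: Comp_assoc_Arr [symmetric])
    then have "b' \<cdot> (\<phi> \<cdot> g) = Zero C W (Cod C b')"
      using bg by simp
    then obtain h where h: "h \<in> Hom C W (Dom C a')" "a' \<cdot> h = \<phi> \<cdot> g"
      using exact_fromD(5) [OF ex W, of "\<phi> \<cdot> g"] by (auto simp: Hom_def)
    have [simp]: "h \<in> Arr C" "Dom C h = W" "Cod C h = Dom C a'"
      using h by (auto simp: Hom_def)
    \<comment> \<open>Evaluating the homotopy relation on g, where b g = 0, gives a y h = g + a s g.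
      So y h - s g is the required lift, and \<open>n\<close> = -s g.\<close>
    obtain n where n: "n \<in> Hom C W (Dom C a)" "(s \<cdot> g) \<oplus>\<oplus> n = Zero C W (Dom C a)"
      using Add_inverse [of "s \<cdot> g" W "Dom C a"] by (auto simp: Hom_def)
    have [simp]: "n \<in> Arr C" "Dom C n = W" "Cod C n = Dom C a"
      using n by (auto simp: Hom_def)
    have "a \<cdot> (y \<cdot> h) = (\<psi> \<cdot> a') \<cdot> h"
      using y(2) by (simp add: Comp_assoc_Arr)
    also have "\<dots> = (\<psi> \<cdot> \<phi>) \<cdot> g"
      using h(2) by (simp add: Comp_assoc_Arr)
    also have "\<dots> = g \<oplus>\<oplus> (a \<cdot> (s \<cdot> g))"
      unfolding s' using bg by (simp add: Add_Comp_Arr Comp_assoc_Arr)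
    finally have "a \<cdot> ((y \<cdot> h) \<oplus>\<oplus> n) = (g \<oplus>\<oplus> (a \<cdot> (s \<cdot> g))) \<oplus>\<oplus> (a \<cdot> n)"
      by (simp add: Comp_Add_Arr)
    also have "\<dots> = g \<oplus>\<oplus> ((a \<cdot> (s \<cdot> g)) \<oplus>\<oplus> (a \<cdot> n))"
      by (rule Add_assoc) (auto simp: Hom_def)
    also have "\<dots> = g \<oplus>\<oplus> (a \<cdot> ((s \<cdot> g) \<oplus>\<oplus> n))"
      by (simp add: Comp_Add_Arr)
    also have "\<dots> = g"
      using n by simp
    finally show ?thesis
      by (intro bexI [of _ "(y \<cdot> h) \<oplus>\<oplus> n"]) (auto simp: Hom_def)
  qed
  then show ?thesis
    using A by (simp add: exact_from_def)
qed

end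

text \<open>The object \<open>M\<close> itself need not lie in \<open>S\<close>, and \<open>Z\<close> may be any object.\<close>

definition into_exact_sequence ::
  "('o, 'm, 'z) preadditive_category_scheme \<Rightarrow> 'o set \<Rightarrow> 'o \<Rightarrow> 'o \<Rightarrow> nat \<Rightarrow> (nat \<Rightarrow> 'm) \<Rightarrow> bool" where
  "into_exact_sequence C S Z M n f \<longleftrightarrow> Z \<in> Obj C \<and> M \<in> Obj C \<and> f 0 = Zero C Z M \<and>
     (\<forall>i<n. exact_into C S (f i) (f (Suc i)) \<and> Cod C (f (Suc i)) \<in> S)"

context preadditive_category
begin

text \<open>Both sequences begin with the same arrow from \<open>Z\<close> to \<open>M\<close>, so
  the induction starts with identities and the zero homotopy. The second disjunct covers this start;
  from then on the codomains lie in \<open>S\<close>.\<close>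

lemma comparison_sequence:
  assumes f: "into_exact_sequence C S Z M n f" and f': "into_exact_sequence C S Z M n f'"
    and "k \<le> n"
  shows "\<exists>\<phi> \<psi> s. comparison C (f k) (f' k) \<phi> \<psi> s \<and>
    (Cod C (f k) \<in> S \<or> \<psi> \<cdot> \<phi> = Ident C (Cod C (f k)) \<oplus>\<oplus> (f k \<cdot> s))"
  using \<open>k \<le> n\<close>
proof (induction k)
  case 0
  have [simp]: "Z \<in> Obj C" "M \<in> Obj C"
    using f by (auto simp: into_exact_sequence_def)
  have "Ident C Z \<in> Hom C Z Z"
    by (simp add: Hom_def)
  then have "comparison C (Zero C Z M) (Zero C Z M) (Ident C M) (Ident C M) (Zero C M Z)"
    unfolding comparison_def by (auto simp: Hom_def Add_Comp_Arr intro: exI [of _ "Ident C Z"])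
  then show ?case
    using f f' by (intro exI [of _ "Ident C M"] exI [of _ "Zero C M Z"])
      (simp add: into_exact_sequence_def)
next
  case (Suc k)
  then have k: "k < n" by simp
  from Suc obtain \<phi> \<psi> s where cmp: "comparison C (f k) (f' k) \<phi> \<psi> s"
    and eq: "Cod C (f k) \<in> S \<or> \<psi> \<cdot> \<phi> = Ident C (Cod C (f k)) \<oplus>\<oplus> (f k \<cdot> s)"
    by auto
  have fk: "exact_into C S (f k) (f (Suc k))" "Cod C (f (Suc k)) \<in> S"
    using f k by (simp_all add: into_exact_sequence_def)
  have fk': "exact_into C S (f' k) (f' (Suc k))" "Cod C (f' (Suc k)) \<in> S"
    using f' k by (simp_all add: into_exact_sequence_def)
  obtain \<phi>' \<psi>' s' where "comparison C (f (Suc k)) (f' (Suc k)) \<phi>' \<psi>' s'"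
    by (rule comparison_step [OF cmp fk(1) fk'(1) fk(2) fk'(2) eq])
  then show ?case
    using fk(2) by blast
qed

lemma into_exact_sequence_exact_from:
  assumes "into_exact_sequence C S Z M n f" "into_exact_sequence C S Z M n f'"
    and "k < n" "exact_from C T (f' k) (f' (Suc k))"
  shows "exact_from C T (f k) (f (Suc k))"
proof -
  obtain \<phi> \<psi> s where cmp: "comparison C (f k) (f' k) \<phi> \<psi> s"
    and eq: "Cod C (f k) \<in> S \<or> \<psi> \<cdot> \<phi> = Ident C (Cod C (f k)) \<oplus>\<oplus> (f k \<cdot> s)"
    using comparison_sequence [OF assms(1,2), of k] \<open>k < n\<close> by auto
  show ?thesis
    by (rule comparison_exact_from [OF cmp _ _ _ _ eq assms(4)])
      (use assms in \<open>auto simp: into_exact_sequence_def\<close>)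
qed

end

section \<open>Prolonging a coresolution by one projective\<close>

context abelian_category
begin

text \<open>The axiom omits the mixed relations. Composing i p + j q = 1 with \<open>p\<close> and
  cancelling \<open>p\<close> leaves p j q = 0, and then q j = 1 gives p j = 0; the relation for q i
  is symmetric.\<close>

lemma biproduct:
  assumes "X \<in> Obj C" "Y \<in> Obj C"
  obtains S i j p q where "i \<in> Hom C X S" "j \<in> Hom C Y S" "p \<in> Hom C S X" "q \<in> Hom C S Y"
    "p \<cdot> i = Ident C X" "q \<cdot> j = Ident C Y" "q \<cdot> i = Zero C X Y" "p \<cdot> j = Zero C Y X"
    "(i \<cdot> p) \<oplus>\<oplus> (j \<cdot> q) = Ident C S"
proof -
  obtain S i j p q where B: "i \<in> Hom C X S" "j \<in> Hom C Y S" "p \<in> Hom C S X" "q \<in> Hom C S Y"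
    and id: "p \<cdot> i = Ident C X" "q \<cdot> j = Ident C Y" "(i \<cdot> p) \<oplus>\<oplus> (j \<cdot> q) = Ident C S"
    using biproduct_exists [OF assms] by blast
  have H [simp]: "i \<in> Arr C" "Dom C i = X" "Cod C i = S" "j \<in> Arr C" "Dom C j = Y" "Cod C j = S"
    "p \<in> Arr C" "Dom C p = S" "Cod C p = X" "q \<in> Arr C" "Dom C q = S" "Cod C q = Y"
    using B by (auto simp: Hom_def)
  have SO [simp]: "S \<in> Obj C"
    using Cod_Obj [of i] by simp
  have "p \<cdot> ((i \<cdot> p) \<oplus>\<oplus> (j \<cdot> q)) = p"
    using id(3) by simp
  moreover have "p \<cdot> (i \<cdot> p) = p"
    using id(1) assms by (simp add: Comp_assoc_Arr [symmetric])
  ultimately have "p \<oplus>\<oplus> (p \<cdot> (j \<cdot> q)) = Zero C S X \<oplus>\<oplus> p"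
    by (simp add: Comp_Add_Arr)
  then have "(p \<cdot> (j \<cdot> q)) \<oplus>\<oplus> p = Zero C S X \<oplus>\<oplus> p"
    by (subst Add_commute [of _ S X]) (simp_all add: Hom_def del: Add_Zero_simps)
  then have "p \<cdot> (j \<cdot> q) = Zero C S X"
    by (rule Add_cancel [rotated 3]) (auto simp: Hom_def assms)
  then have "(p \<cdot> (j \<cdot> q)) \<cdot> j = Zero C Y X"
    using assms by simp
  then have pj: "p \<cdot> j = Zero C Y X"
    using id(2) by (simp add: Comp_assoc_Arr)
  have "q \<cdot> ((i \<cdot> p) \<oplus>\<oplus> (j \<cdot> q)) = q"
    using id(3) by simp
  moreover have "q \<cdot> (j \<cdot> q) = q"
    using id(2) assms by (simp add: Comp_assoc_Arr [symmetric])
  ultimately have "(q \<cdot> (i \<cdot> p)) \<oplus>\<oplus> q = Zero C S Y \<oplus>\<oplus> q"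
    by (simp add: Comp_Add_Arr)
  then have "q \<cdot> (i \<cdot> p) = Zero C S Y"
    by (rule Add_cancel [rotated 3]) (auto simp: Hom_def assms)
  then have "(q \<cdot> (i \<cdot> p)) \<cdot> i = Zero C X Y"
    using assms by simp
  then have qi: "q \<cdot> i = Zero C X Y"
    using id(1) by (simp add: Comp_assoc_Arr)
  show ?thesis
    by (rule that [OF B id(1,2) qi pj id(3)])
qed

lemma biproduct_Proj:
  assumes PQ: "P \<in> Proj C" "Q \<in> Proj C"
    and B: "i \<in> Hom C P S" "j \<in> Hom C Q S" "p \<in> Hom C S P" "q \<in> Hom C S Q"
    and id: "(i \<cdot> p) \<oplus>\<oplus> (j \<cdot> q) = Ident C S"
  shows "S \<in> Proj C"
proof -
  have H [simp]: "i \<in> Arr C" "Dom C i = P" "Cod C i = S" "j \<in> Arr C" "Dom C j = Q" "Cod C j = S"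
    "p \<in> Arr C" "Dom C p = S" "Cod C p = P" "q \<in> Arr C" "Dom C q = S" "Cod C q = Q"
    using B by (auto simp: Hom_def)
  have "\<exists>h \<in> Hom C S (Dom C e). e \<cdot> h = g"
    if e: "is_epi C e" and g: "g \<in> Hom C S (Cod C e)" for e g
  proof -
    have [simp]: "e \<in> Arr C" "g \<in> Arr C" "Dom C g = S" "Cod C g = Cod C e"
      using e g by (auto simp: is_epi_def Hom_def)
    obtain h where h: "h \<in> Hom C P (Dom C e)" "e \<cdot> h = g \<cdot> i"
      using Proj_lift [OF PQ(1) e, of "g \<cdot> i"] by (auto simp: Hom_def)
    obtain k where k: "k \<in> Hom C Q (Dom C e)" "e \<cdot> k = g \<cdot> j"
      using Proj_lift [OF PQ(2) e, of "g \<cdot> j"] by (auto simp: Hom_def)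
    have [simp]: "h \<in> Arr C" "Dom C h = P" "Cod C h = Dom C e"
      "k \<in> Arr C" "Dom C k = Q" "Cod C k = Dom C e"
      using h k by (auto simp: Hom_def)
    have "e \<cdot> ((h \<cdot> p) \<oplus>\<oplus> (k \<cdot> q)) = ((e \<cdot> h) \<cdot> p) \<oplus>\<oplus> ((e \<cdot> k) \<cdot> q)"
      by (simp add: Comp_Add_Arr Comp_assoc_Arr)
    also have "\<dots> = g \<cdot> ((i \<cdot> p) \<oplus>\<oplus> (j \<cdot> q))"
      unfolding h k by (simp add: Comp_Add_Arr Comp_assoc_Arr)
    finally show ?thesis
      using id by (intro bexI [of _ "(h \<cdot> p) \<oplus>\<oplus> (k \<cdot> q)"]) (auto simp: Hom_def)
  qed
  then show ?thesis
    using Cod_Obj [of i] by (simp add: Proj_def)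
qed

text \<open>The arrow \<open>b\<close> has components \<open>b' \<phi>\<close> and \<open>\<psi> \<phi> - 1 - a s\<close>: if \<open>g\<close> vanishes on \<open>a\<close> and
  \<open>g \<psi> = h b'\<close>, then \<open>g = h (b' \<phi>) - g (\<psi> \<phi> - 1 - a s)\<close>.\<close>

lemma exact_into_extension:
  assumes cmp: "comparison C a a' \<phi> \<psi> s" and a: "a \<in> Arr C"
    and ab': "exact_into C (Proj C) a' b'"
    and P: "Cod C a \<in> Proj C" "Cod C b' \<in> Proj C"
  obtains b where "exact_into C (Proj C) a b" "Cod C b \<in> Proj C"
proof -
  note A' = exact_intoD(1-4) [OF ab']
  obtain x y where x: "x \<in> Hom C (Dom C a) (Dom C a')" "\<phi> \<cdot> a = a' \<cdot> x"
    and y: "y \<in> Hom C (Dom C a') (Dom C a)" "\<psi> \<cdot> a' = a \<cdot> y"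
    and com: "(\<psi> \<cdot> \<phi>) \<cdot> a = (Ident C (Cod C a) \<oplus>\<oplus> (a \<cdot> s)) \<cdot> a"
    using cmp by (auto simp: comparison_def)
  have H [simp]: "\<phi> \<in> Arr C" "Dom C \<phi> = Cod C a" "Cod C \<phi> = Dom C b'"
    "\<psi> \<in> Arr C" "Dom C \<psi> = Dom C b'" "Cod C \<psi> = Cod C a"
    "s \<in> Arr C" "Dom C s = Cod C a" "Cod C s = Dom C a"
    "x \<in> Arr C" "Dom C x = Dom C a" "Cod C x = Dom C a'"
    "y \<in> Arr C" "Dom C y = Dom C a'" "Cod C y = Dom C a"
    "a \<in> Arr C" "a' \<in> Arr C" "b' \<in> Arr C" "Cod C a' = Dom C b'"
    using cmp x y a A' by (auto simp: comparison_def Hom_def)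
  define v where "v = Ident C (Cod C a) \<oplus>\<oplus> (a \<cdot> s)"
  have [simp]: "v \<in> Arr C" "Dom C v = Cod C a" "Cod C v = Cod C a"
    by (simp_all add: v_def)
  obtain n where n: "n \<in> Hom C (Cod C a) (Cod C a)" "v \<oplus>\<oplus> n = Zero C (Cod C a) (Cod C a)"
    "n \<oplus>\<oplus> v = Zero C (Cod C a) (Cod C a)"
    using Add_inverse [of v "Cod C a" "Cod C a"] by (auto simp: Hom_def)
  have [simp]: "n \<in> Arr C" "Dom C n = Cod C a" "Cod C n = Cod C a"
    using n(1) by (auto simp: Hom_def)
  \<comment> \<open>With \<open>v\<close> = 1 + a s and \<open>n\<close> = -v this is the homotopy
    error \<psi> \<phi> - v, which vanishes on \<open>a\<close> by the last clause of
    \<open>comparison\<close>.\<close>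
  define t where "t = n \<oplus>\<oplus> (\<psi> \<cdot> \<phi>)"
  have [simp]: "t \<in> Arr C" "Dom C t = Cod C a" "Cod C t = Cod C a"
    by (simp_all add: t_def)
  have "v \<oplus>\<oplus> t = (v \<oplus>\<oplus> n) \<oplus>\<oplus> (\<psi> \<cdot> \<phi>)"
    unfolding t_def by (rule Add_assoc [symmetric]) (auto simp: Hom_def)
  then have vt: "v \<oplus>\<oplus> t = \<psi> \<cdot> \<phi>"
    using n by simp
  have "t \<cdot> a = (n \<oplus>\<oplus> v) \<cdot> a"
    using com by (simp add: t_def v_def [symmetric] Add_Comp_Arr)
  then have ta: "t \<cdot> a = Zero C (Dom C a) (Cod C a)"
    using n by simp
  obtain S i j p q where B: "i \<in> Hom C (Cod C b') S" "j \<in> Hom C (Cod C a) S"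
      "p \<in> Hom C S (Cod C b')" "q \<in> Hom C S (Cod C a)"
    and id: "p \<cdot> i = Ident C (Cod C b')" "q \<cdot> j = Ident C (Cod C a)"
      "q \<cdot> i = Zero C (Cod C b') (Cod C a)" "p \<cdot> j = Zero C (Cod C a) (Cod C b')"
      "(i \<cdot> p) \<oplus>\<oplus> (j \<cdot> q) = Ident C S"
    by (rule biproduct [OF Cod_Obj [OF A'(2)] Cod_Obj [OF a]])
  have S: "S \<in> Proj C"
    using biproduct_Proj [OF P(2,1) B id(5)] .
  have [simp]: "i \<in> Arr C" "Dom C i = Cod C b'" "Cod C i = S"
    "j \<in> Arr C" "Dom C j = Cod C a" "Cod C j = S" "p \<in> Arr C" "Dom C p = S" "Cod C p = Cod C b'"
    "q \<in> Arr C" "Dom C q = S" "Cod C q = Cod C a" "S \<in> Obj C"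
    using B S by (auto simp: Hom_def Proj_Obj)
  define r where "r = b' \<cdot> \<phi>"
  have [simp]: "r \<in> Arr C" "Dom C r = Cod C a" "Cod C r = Cod C b'"
    by (simp_all add: r_def)
  have "r \<cdot> a = (b' \<cdot> a') \<cdot> x"
    using x(2) by (simp add: r_def Comp_assoc_Arr)
  then have ra: "r \<cdot> a = Zero C (Dom C a) (Cod C b')"
    using A' by simp
  define b where "b = (i \<cdot> r) \<oplus>\<oplus> (j \<cdot> t)"
  have [simp]: "b \<in> Arr C" "Dom C b = Cod C a" "Cod C b = S"
    by (simp_all add: b_def)
  have pb: "p \<cdot> b = r"
    using id by (simp add: b_def Comp_Add_Arr Comp_assoc_Arr [symmetric])
  have qb: "q \<cdot> b = t"
    using id by (simp add: b_def Comp_Add_Arr Comp_assoc_Arr [symmetric])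
  have "b \<cdot> a = Zero C (Dom C a) S"
    using ra ta by (simp add: b_def Add_Comp_Arr Comp_assoc_Arr)
  moreover have "\<exists>h \<in> Hom C S Q. h \<cdot> b = g"
    if Q: "Q \<in> Proj C" and g: "g \<in> Hom C (Cod C a) Q" and ga: "g \<cdot> a = Zero C (Dom C a) Q" for Q g
  proof -
    have [simp]: "g \<in> Arr C" "Dom C g = Cod C a" "Cod C g = Q" "Q \<in> Obj C"
      using g by (auto simp: Hom_def)
    have "(g \<cdot> \<psi>) \<cdot> a' = (g \<cdot> a) \<cdot> y"
      using y(2) by (simp add: Comp_assoc_Arr)
    then have "(g \<cdot> \<psi>) \<cdot> a' = Zero C (Dom C a') Q"
      using ga by simp
    then obtain h where h: "h \<in> Hom C (Cod C b') Q" "h \<cdot> b' = g \<cdot> \<psi>"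
      using exact_intoD(5) [OF ab' Q, of "g \<cdot> \<psi>"] by (auto simp: Hom_def)
    have [simp]: "h \<in> Arr C" "Dom C h = Cod C b'" "Cod C h = Q"
      using h by (auto simp: Hom_def)
    obtain m where m: "m \<in> Hom C (Cod C a) Q" "g \<oplus>\<oplus> m = Zero C (Cod C a) Q"
      using Add_inverse [of g "Cod C a" Q] g by metis
    have [simp]: "m \<in> Arr C" "Dom C m = Cod C a" "Cod C m = Q"
      using m by (auto simp: Hom_def)
    have "g \<cdot> (a \<cdot> s) = Zero C (Cod C a) Q"
      using ga Comp_assoc_Arr [of s a g] by simp
    then have gv: "g \<cdot> v = g"
      by (simp add: v_def Comp_Add_Arr)
    have "h \<cdot> r = (h \<cdot> b') \<cdot> \<phi>"
      by (simp add: r_def Comp_assoc_Arr)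
    also have "\<dots> = g \<cdot> (v \<oplus>\<oplus> t)"
      using h(2) vt by (simp add: Comp_assoc_Arr)
    also have "\<dots> = g \<oplus>\<oplus> (g \<cdot> t)"
      using gv by (simp add: Comp_Add_Arr)
    finally have hr: "h \<cdot> r = g \<oplus>\<oplus> (g \<cdot> t)" .
    have "((h \<cdot> p) \<oplus>\<oplus> (m \<cdot> q)) \<cdot> b = (g \<oplus>\<oplus> (g \<cdot> t)) \<oplus>\<oplus> (m \<cdot> t)"
      using pb qb hr by (simp add: Add_Comp_Arr Comp_assoc_Arr)
    also have "\<dots> = g \<oplus>\<oplus> ((g \<cdot> t) \<oplus>\<oplus> (m \<cdot> t))"
      by (rule Add_assoc) (auto simp: Hom_def)
    also have "\<dots> = g \<oplus>\<oplus> ((g \<oplus>\<oplus> m) \<cdot> t)"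
      by (simp add: Add_Comp_Arr)
    also have "\<dots> = g"
      using m by simp
    finally show ?thesis
      by (intro bexI [of _ "(h \<cdot> p) \<oplus>\<oplus> (m \<cdot> q)"]) (auto simp: Hom_def)
  qed
  ultimately have "exact_into C (Proj C) a b"
    by (simp add: exact_into_def)
  then show ?thesis
    using that S by simp
qed

text \<open>The longer sequence \<open>f'\<close> need not agree with \<open>f\<close> beyond the
  first arrow; it only certifies that \<open>f\<close> can be continued.\<close>

lemma into_exact_sequence_extension:
  assumes f: "into_exact_sequence C (Proj C) Z M n f"
    and f': "into_exact_sequence C (Proj C) Z M (Suc n) f'"
  obtains b where "exact_into C (Proj C) (f n) b" "Cod C b \<in> Proj C"
proof (cases n)
  \<comment> \<open>The biproduct construction needs the codomain of the last arrow to be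
    projective, which \<open>M\<close> need not be. Here, however, \<open>f\<close> and
    \<open>f'\<close> both consist of the arrow from \<open>Z\<close> to \<open>M\<close> so far,
    and the next arrow of \<open>f'\<close> can be taken as it is.\<close>
  case 0
  then show ?thesis
    using f f' that [of "f' 1"] by (auto simp: into_exact_sequence_def)
next
  case (Suc m)
  have "into_exact_sequence C (Proj C) Z M n f'"
    using f' by (simp add: into_exact_sequence_def)
  then obtain \<phi> \<psi> s where cmp: "comparison C (f n) (f' n) \<phi> \<psi> s"
    using comparison_sequence [OF f] by blast
  have fm: "exact_into C (Proj C) (f m) (f n)" "Cod C (f n) \<in> Proj C"
    using f Suc by (auto simp: into_exact_sequence_def)
  then show ?thesis
    using exact_into_extension [OF cmp exact_intoD(2) [OF fm(1)], of "f' (Suc n)"] f' that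
    by (auto simp: into_exact_sequence_def)
qed

lemma infinite_into_exact_sequence:
  assumes "\<And>n. \<exists>f. into_exact_sequence C (Proj C) Z M n f"
  obtains f where "\<And>n. into_exact_sequence C (Proj C) Z M n f"
proof -
  \<comment> \<open>Exactness is a condition on consecutive arrows, so the recursive choice only has
    to remember the last arrow of some sequence of length \<open>n\<close>, not the
    sequence.\<close>
  define R where "R n a \<longleftrightarrow> (\<exists>f. into_exact_sequence C (Proj C) Z M n f \<and> f n = a)" for n a
  have ZM: "Z \<in> Obj C" "M \<in> Obj C"
    using assms [of 0] by (auto simp: into_exact_sequence_def)
  have "\<exists>b. R (Suc n) b \<and> exact_into C (Proj C) a b \<and> Cod C b \<in> Proj C" if a: "R n a" for n a
  proof -
    obtain f f' where f: "into_exact_sequence C (Proj C) Z M n f" "f n = a"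
      and f': "into_exact_sequence C (Proj C) Z M (Suc n) f'"
      using a assms unfolding R_def by metis
    obtain b where b: "exact_into C (Proj C) (f n) b" "Cod C b \<in> Proj C"
      using into_exact_sequence_extension [OF f(1) f'] .
    have "into_exact_sequence C (Proj C) Z M (Suc n) (f(Suc n := b))"
      using f b by (auto simp: into_exact_sequence_def less_Suc_eq)
    then have "R (Suc n) b"
      unfolding R_def by (metis fun_upd_same)
    then show ?thesis
      using b f(2) by auto
  qed
  moreover have "\<exists>a. R 0 a \<and> (0 = (0::nat) \<longrightarrow> a = Zero C Z M)"
    using ZM unfolding R_def into_exact_sequence_def by (intro exI [of _ "Zero C Z M"]) auto
  ultimately obtain f where "\<forall>n. (R n (f n) \<and> (n = 0 \<longrightarrow> f n = Zero C Z M))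
      \<and> exact_into C (Proj C) (f n) (f (Suc n)) \<and> Cod C (f (Suc n)) \<in> Proj C"
    using dependent_nat_choice [of "\<lambda>n a. R n a \<and> (n = 0 \<longrightarrow> a = Zero C Z M)"
        "\<lambda>_ a b. exact_into C (Proj C) a b \<and> Cod C b \<in> Proj C"] by (metis Suc_neq_Zero)
  then show ?thesis
    using ZM by (intro that [of f]) (auto simp: into_exact_sequence_def)
qed

end

section \<open>Monomorphisms, epimorphisms, kernels and images\<close>

context preadditive_category
begin

lemma mono_cancel_zero:
  assumes "is_mono C m" "f \<in> Hom C W (Dom C m)" "m \<cdot> f = Zero C W (Cod C m)"
  shows "f = Zero C W (Dom C m)"
proof (rule is_mono_cancel [OF assms(1,2)])
  have [simp]: "W \<in> Obj C" "m \<in> Arr C"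
    using assms by (auto simp: Hom_def is_mono_def)
  show "Zero C W (Dom C m) \<in> Hom C W (Dom C m)" "m \<cdot> f = m \<cdot> Zero C W (Dom C m)"
    using assms(3) by (simp_all add: Hom_def)
qed

lemma epi_cancel_zero:
  assumes "is_epi C e" "f \<in> Hom C (Cod C e) W" "f \<cdot> e = Zero C (Dom C e) W"
  shows "f = Zero C (Cod C e) W"
proof (rule is_epi_cancel [OF assms(1,2)])
  have [simp]: "W \<in> Obj C" "e \<in> Arr C"
    using assms by (auto simp: Hom_def is_epi_def)
  show "Zero C (Cod C e) W \<in> Hom C (Cod C e) W" "f \<cdot> e = Zero C (Cod C e) W \<cdot> e"
    using assms(3) by (simp_all add: Hom_def)
qed

lemma is_epiI_zero:
  assumes [simp]: "e \<in> Arr C"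
    and zero: "\<And>W t. \<lbrakk>t \<in> Hom C (Cod C e) W; t \<cdot> e = Zero C (Dom C e) W\<rbrakk> \<Longrightarrow> t = Zero C (Cod C e) W"
  shows "is_epi C e"
proof -
  have "g = h" if gh: "g \<in> Hom C (Cod C e) W" "h \<in> Hom C (Cod C e) W" and eq: "g \<cdot> e = h \<cdot> e" for W g h
  proof -
    obtain n where n: "n \<in> Hom C (Cod C e) W" "h \<oplus>\<oplus> n = Zero C (Cod C e) W"
      using Add_inverse [OF gh(2)] by metis
    have [simp]: "g \<in> Arr C" "Dom C g = Cod C e" "Cod C g = W" "h \<in> Arr C" "Dom C h = Cod C e" "Cod C h = W"
      "n \<in> Arr C" "Dom C n = Cod C e" "Cod C n = W" "W \<in> Obj C"
      using gh n by (auto simp: Hom_def)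
    have "(g \<oplus>\<oplus> n) \<cdot> e = (h \<oplus>\<oplus> n) \<cdot> e"
      using eq by (simp add: Add_Comp_Arr)
    also have "\<dots> = Zero C (Dom C e) W"
      using n by simp
    finally have "g \<oplus>\<oplus> n = Zero C (Cod C e) W"
      by (intro zero) (simp_all add: Hom_def)
    then have "g \<oplus>\<oplus> n = h \<oplus>\<oplus> n"
      using n by simp
    then show ?thesis
      using Add_cancel [OF gh n(1)] by simp
  qed
  then show ?thesis
    by (auto simp: is_epi_def)
qed

lemma is_monoI_zero:
  assumes "m \<in> Arr C"
    and "\<And>W t. \<lbrakk>t \<in> Hom C W (Dom C m); m \<cdot> t = Zero C W (Cod C m)\<rbrakk> \<Longrightarrow> t = Zero C W (Dom C m)"
  shows "is_mono C m"
proof -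
  interpret op: preadditive_category "opposite C"
    by (rule preadditive_category_opposite)
  show ?thesis
    using op.is_epiI_zero [of m] assms by (simp add: is_epi_opposite)
qed

end

context abelian_category
begin

lemma kernelD:
  assumes "is_kernel C f k"
  shows "f \<in> Arr C" "k \<in> Arr C" "Cod C k = Dom C f" "f \<cdot> k = Zero C (Dom C k) (Cod C f)"
    and "\<lbrakk>h \<in> Hom C W (Dom C f); f \<cdot> h = Zero C W (Cod C f)\<rbrakk>
      \<Longrightarrow> \<exists>u. u \<in> Hom C W (Dom C k) \<and> k \<cdot> u = h"
  using assms unfolding is_kernel_def by blast+

lemma cokernelD:
  assumes "is_cokernel C f c"
  shows "f \<in> Arr C" "c \<in> Arr C" "Dom C c = Cod C f" "c \<cdot> f = Zero C (Dom C f) (Cod C c)"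
    and "\<lbrakk>h \<in> Hom C (Cod C f) W; h \<cdot> f = Zero C (Dom C f) W\<rbrakk>
      \<Longrightarrow> \<exists>u. u \<in> Hom C (Cod C c) W \<and> u \<cdot> c = h"
  using assms unfolding is_cokernel_def by blast+

lemma kernel_mono:
  assumes "is_kernel C f k"
  shows "is_mono C k"
proof -
  note K = kernelD(1-4) [OF assms]
  have "g = h" if gh: "g \<in> Hom C W (Dom C k)" "h \<in> Hom C W (Dom C k)" and eq: "k \<cdot> g = k \<cdot> h" for W g h
  proof -
    have [simp]: "g \<in> Arr C" "Dom C g = W" "Cod C g = Dom C k" "W \<in> Obj C"
      using gh by (auto simp: Hom_def)
    have "f \<cdot> (k \<cdot> g) = Zero C W (Cod C f)"
      using K by (simp add: Comp_assoc_Arr [symmetric])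
    moreover have "k \<cdot> g \<in> Hom C W (Dom C f)"
      using K by (simp add: Hom_def)
    ultimately have "\<exists>!u. u \<in> Hom C W (Dom C k) \<and> k \<cdot> u = k \<cdot> g"
      using assms unfolding is_kernel_def by blast
    then show ?thesis
      using gh eq by metis
  qed
  then show ?thesis
    using K by (auto simp: is_mono_def)
qed

lemma is_kernelI:
  assumes [simp]: "f \<in> Arr C" and m: "is_mono C k" and "Cod C k = Dom C f"
    and "f \<cdot> k = Zero C (Dom C k) (Cod C f)"
    and "\<And>W h. \<lbrakk>h \<in> Hom C W (Dom C f); f \<cdot> h = Zero C W (Cod C f)\<rbrakk>
      \<Longrightarrow> \<exists>u \<in> Hom C W (Dom C k). k \<cdot> u = h"
  shows "is_kernel C f k"
proof -
  have "\<exists>!u. u \<in> Hom C W (Dom C k) \<and> k \<cdot> u = h"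
    if "h \<in> Hom C W (Dom C f)" "f \<cdot> h = Zero C W (Cod C f)" for W h
    using assms(5) [OF that] is_mono_cancel [OF m] by metis
  then show ?thesis
    using assms(3,4) m unfolding is_kernel_def is_mono_def by simp
qed

lemma is_mono_Comp:
  assumes m: "is_mono C m" and k: "is_mono C k" and [simp]: "Cod C k = Dom C m"
  shows "is_mono C (m \<cdot> k)"
proof -
  have [simp]: "m \<in> Arr C" "k \<in> Arr C"
    using m k by (auto simp: is_mono_def)
  have "g = h" if gh: "g \<in> Hom C W (Dom C k)" "h \<in> Hom C W (Dom C k)"
    and eq: "(m \<cdot> k) \<cdot> g = (m \<cdot> k) \<cdot> h" for W g h
  proof -
    have [simp]: "g \<in> Arr C" "Dom C g = W" "Cod C g = Dom C k" "h \<in> Arr C" "Dom C h = W" "Cod C h = Dom C k"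
      using gh by (auto simp: Hom_def)
    have "m \<cdot> (k \<cdot> g) = m \<cdot> (k \<cdot> h)"
      using eq by (simp add: Comp_assoc_Arr)
    then have "k \<cdot> g = k \<cdot> h"
      using is_mono_cancel [OF m, of "k \<cdot> g" W "k \<cdot> h"] by (simp add: Hom_def)
    then show ?thesis
      using is_mono_cancel [OF k gh] by simp
  qed
  then show ?thesis
    by (auto simp: is_mono_def)
qed

lemma image_exists:
  assumes "f \<in> Arr C"
  obtains m where "is_image C f m"
  using cokernel_exists [OF assms] kernel_exists cokernelD(2) unfolding is_image_def by metis

text \<open>The point is that \<open>e\<close> is epi. If t e = 0 and k is a kernel of t, then f
  factors through the mono m k, which is a kernel of some r. Since r f = 0, r factors through the
  cokernel c of f, so r m = 0 and m factors through m k. Hence k has a right inverse, and t k = 0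
  forces t = 0.\<close>

lemma image_factor:
  assumes "is_image C f m"
  obtains e where "e \<in> Hom C (Dom C f) (Dom C m)" "is_epi C e" "m \<cdot> e = f" "is_mono C m"
    "Cod C m = Cod C f"
proof -
  obtain c where c: "is_cokernel C f c" and m: "is_kernel C c m"
    using assms by (auto simp: is_image_def)
  note K = kernelD(1-4) [OF m] and L = cokernelD(1-4) [OF c]
  have mono: "is_mono C m"
    using kernel_mono [OF m] .
  have [simp]: "f \<in> Arr C" "m \<in> Arr C" "c \<in> Arr C" "Dom C c = Cod C f" "Cod C m = Cod C f"
    using K L by auto
  obtain e where e: "e \<in> Hom C (Dom C f) (Dom C m)" "m \<cdot> e = f"
    using kernelD(5) [OF m, of f "Dom C f"] L by (auto simp: Hom_def)
  have [simp]: "e \<in> Arr C" "Dom C e = Dom C f" "Cod C e = Dom C m"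
    using e by (auto simp: Hom_def)
  have "is_epi C e"
  proof (rule is_epiI_zero)
    fix W t assume t: "t \<in> Hom C (Cod C e) W" and te: "t \<cdot> e = Zero C (Dom C e) W"
    have [simp]: "t \<in> Arr C" "Dom C t = Dom C m" "Cod C t = W" "W \<in> Obj C"
      using t by (auto simp: Hom_def)
    obtain k where k: "is_kernel C t k"
      using kernel_exists [of t] by auto
    note k' = kernelD(1-4) [OF k]
    have [simp]: "k \<in> Arr C" "Cod C k = Dom C m"
      using k' by auto
    obtain e' where e': "e' \<in> Hom C (Dom C f) (Dom C k)" "k \<cdot> e' = e"
      using kernelD(5) [OF k, of e "Dom C f"] te by (auto simp: Hom_def)
    have [simp]: "e' \<in> Arr C" "Dom C e' = Dom C f" "Cod C e' = Dom C k"
      using e' by (auto simp: Hom_def)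
    have "is_mono C (m \<cdot> k)"
      by (rule is_mono_Comp [OF mono kernel_mono [OF k]]) simp
    then obtain r where r: "is_kernel C r (m \<cdot> k)"
      using mono_is_kernel by blast
    note r' = kernelD(1-4) [OF r]
    have [simp]: "r \<in> Arr C" "Dom C r = Cod C f"
      using r' by auto
    have "r \<cdot> f = r \<cdot> (m \<cdot> (k \<cdot> e'))"
      using e e' by simp
    also have "\<dots> = (r \<cdot> (m \<cdot> k)) \<cdot> e'"
      by (simp add: Comp_assoc_Arr)
    finally have "r \<cdot> f = Zero C (Dom C f) (Cod C r)"
      using r' by simp
    then obtain u where u: "u \<in> Hom C (Cod C c) (Cod C r)" "u \<cdot> c = r"
      using cokernelD(5) [OF c, of r "Cod C r"] by (auto simp: Hom_def)
    have [simp]: "u \<in> Arr C" "Dom C u = Cod C c" "Cod C u = Cod C r"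
      using u by (auto simp: Hom_def)
    have "r \<cdot> m = u \<cdot> (c \<cdot> m)"
      using u(2) Comp_assoc_Arr [of m c u] by simp
    then have "r \<cdot> m = Zero C (Dom C m) (Cod C r)"
      using K by simp
    then obtain s where s: "s \<in> Hom C (Dom C m) (Dom C k)" "(m \<cdot> k) \<cdot> s = m"
      using kernelD(5) [OF r, of m "Dom C m"] by (auto simp: Hom_def)
    have [simp]: "s \<in> Arr C" "Dom C s = Dom C m" "Cod C s = Dom C k"
      using s by (auto simp: Hom_def)
    have "m \<cdot> (k \<cdot> s) = m \<cdot> Ident C (Dom C m)"
      using s(2) by (simp add: Comp_assoc_Arr)
    then have "k \<cdot> s = Ident C (Dom C m)"
      using is_mono_cancel [OF mono, of "k \<cdot> s" "Dom C m"] by (simp add: Hom_def)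
    then have "t = (t \<cdot> k) \<cdot> s"
      by (simp add: Comp_assoc_Arr)
    then show "t = Zero C (Cod C e) W"
      using k' by simp
  qed simp
  then show ?thesis
    using that e mono by simp
qed

end

section \<open>Exactness in the presence of enough projectives\<close>

context abelian_category_enough_projectives
begin

lemma projective_cover:
  assumes "X \<in> Obj C"
  obtains P e where "P \<in> Proj C" "is_epi C e" "e \<in> Arr C" "Dom C e = P" "Cod C e = X" "P \<in> Obj C"
  using enough_projectives [OF assms] Proj_Obj by (auto simp: Hom_def)

text \<open>Exactness on projective test objects reaches an arbitrary \<open>W\<close> through an
  epi p from a projective: r p lifts along \<open>a\<close>, so g r p = 0, and p cancels. A lift of
  r itself need not exist.\<close>

lemma exact_from_cancel:
  assumes ab: "exact_from C (Proj C) a b"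
    and r: "r \<in> Hom C W (Dom C b)" "b \<cdot> r = Zero C W (Cod C b)"
    and g: "g \<in> Hom C (Dom C b) V" "g \<cdot> a = Zero C (Dom C a) V"
  shows "g \<cdot> r = Zero C W V"
proof -
  note A = exact_fromD(1-4) [OF ab]
  have [simp]: "r \<in> Arr C" "Dom C r = W" "Cod C r = Dom C b" "g \<in> Arr C" "Dom C g = Dom C b" "Cod C g = V"
    "W \<in> Obj C" "V \<in> Obj C" "a \<in> Arr C" "b \<in> Arr C" "Cod C a = Dom C b"
    using r g A by (auto simp: Hom_def)
  obtain P p where p: "P \<in> Proj C" "is_epi C p" and [simp]: "p \<in> Arr C" "Dom C p = P" "Cod C p = W" "P \<in> Obj C"
    using projective_cover [of W] by auto
  have "b \<cdot> (r \<cdot> p) = Zero C P (Cod C b)"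
    using r by (simp add: Comp_assoc_Arr [symmetric])
  then obtain h where h: "h \<in> Hom C P (Dom C a)" "a \<cdot> h = r \<cdot> p"
    using exact_fromD(5) [OF ab p(1), of "r \<cdot> p"] by (auto simp: Hom_def)
  have [simp]: "h \<in> Arr C" "Dom C h = P" "Cod C h = Dom C a"
    using h by (auto simp: Hom_def)
  have "(g \<cdot> r) \<cdot> p = (g \<cdot> a) \<cdot> h"
    using h by (simp add: Comp_assoc_Arr)
  also have "\<dots> = Zero C P V"
    using g by simp
  finally show ?thesis
    using epi_cancel_zero [OF p(2), of "g \<cdot> r" V] by (simp add: Hom_def)
qed

text \<open>Forwards, a map from a projective into Ker b = Im a is lifted along the epi from Dom a
  onto the image. Backwards, the image of \<open>a\<close> is shown to be a kernel of
  \<open>b\<close>.\<close>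

lemma exact_pair_iff: "exact_pair C a b \<longleftrightarrow> exact_from C (Proj C) a b"
proof
  assume ab: "exact_pair C a b"
  then obtain m where m: "is_image C a m" "is_kernel C b m"
    by (auto simp: exact_pair_def)
  note K = kernelD(1-4) [OF m(2)]
  obtain e where e: "e \<in> Hom C (Dom C a) (Dom C m)" "is_epi C e" "m \<cdot> e = a"
    using image_factor [OF m(1)] by metis
  have [simp]: "e \<in> Arr C" "Dom C e = Dom C a" "Cod C e = Dom C m" "a \<in> Arr C" "b \<in> Arr C" "m \<in> Arr C"
    "Cod C a = Dom C b" "Cod C m = Dom C b"
    using e ab K by (auto simp: Hom_def exact_pair_def)
  have "b \<cdot> a = (b \<cdot> m) \<cdot> e"
    using e(3) by (simp add: Comp_assoc_Arr)
  then have ba: "b \<cdot> a = Zero C (Dom C a) (Cod C b)"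
    using K by simp
  have "\<exists>h \<in> Hom C W (Dom C a). a \<cdot> h = g"
    if W: "W \<in> Proj C" and g: "g \<in> Hom C W (Dom C b)" "b \<cdot> g = Zero C W (Cod C b)" for W g
  proof -
    obtain u where u: "u \<in> Hom C W (Dom C m)" "m \<cdot> u = g"
      using kernelD(5) [OF m(2) g] by auto
    obtain h where h: "h \<in> Hom C W (Dom C e)" "e \<cdot> h = u"
      using Proj_lift [OF W e(2), of u] u by auto
    have "(m \<cdot> e) \<cdot> h = m \<cdot> (e \<cdot> h)"
      using h(1) by (simp add: Comp_assoc_Arr Hom_def)
    then show ?thesis
      using h u e(3) by auto
  qed
  then show "exact_from C (Proj C) a b"
    using ba by (simp add: exact_from_def)
next
  assume ab: "exact_from C (Proj C) a b"
  note A = exact_fromD(1-4) [OF ab]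
  obtain c where c: "is_cokernel C a c"
    using cokernel_exists A by blast
  obtain m where m: "is_kernel C c m"
    using kernel_exists cokernelD(2) [OF c] by blast
  have im: "is_image C a m"
    using c m by (auto simp: is_image_def)
  obtain e where e: "e \<in> Hom C (Dom C a) (Dom C m)" "is_epi C e" "m \<cdot> e = a"
    and mono: "is_mono C m" "Cod C m = Cod C a"
    using image_factor [OF im] by metis
  note L = cokernelD(1-4) [OF c]
  have [simp]: "e \<in> Arr C" "Dom C e = Dom C a" "Cod C e = Dom C m" "a \<in> Arr C" "b \<in> Arr C" "m \<in> Arr C"
    "Cod C a = Dom C b" "Cod C m = Dom C b" "c \<in> Arr C" "Dom C c = Dom C b"
    using e A mono kernelD(2) [OF m] L by (auto simp: Hom_def)
  have "(b \<cdot> m) \<cdot> e = Zero C (Dom C e) (Cod C b)"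
    using e(3) A by (simp add: Comp_assoc_Arr)
  then have bm: "b \<cdot> m = Zero C (Dom C m) (Cod C b)"
    using epi_cancel_zero [OF e(2), of "b \<cdot> m"] by (simp add: Hom_def)
  have "is_kernel C b m"
  proof (rule is_kernelI)
    fix W h assume h: "h \<in> Hom C W (Dom C b)" "b \<cdot> h = Zero C W (Cod C b)"
    \<comment> \<open>The cokernel \<open>c\<close> kills \<open>a\<close>, hence also everything
      killed by \<open>b\<close>; so h factors through m, a kernel of \<open>c\<close>.\<close>
    have "c \<cdot> h = Zero C W (Cod C c)"
      by (rule exact_from_cancel [OF ab h]) (use L in \<open>auto simp: Hom_def\<close>)
    then show "\<exists>u \<in> Hom C W (Dom C m). m \<cdot> u = h"
      using kernelD(5) [OF m, of h W] h by auto
  qed (use bm mono in simp_all)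
  then show "exact_pair C a b"
    using im by (auto simp: exact_pair_def)
qed

lemma exact_from_Zero_iff:
  assumes [simp]: "Z \<in> Obj C" "e \<in> Arr C"
  shows "exact_from C (Proj C) e (Zero C (Cod C e) Z) \<longleftrightarrow> is_epi C e"
proof
  assume ex: "exact_from C (Proj C) e (Zero C (Cod C e) Z)"
  show "is_epi C e"
  proof (rule is_epiI_zero)
    fix W t assume t: "t \<in> Hom C (Cod C e) W" "t \<cdot> e = Zero C (Dom C e) W"
    have "t \<cdot> Ident C (Cod C e) = Zero C (Cod C e) W"
      by (rule exact_from_cancel [OF ex]) (use t in \<open>auto simp: Hom_def\<close>)
    then show "t = Zero C (Cod C e) W"
      using t by (simp add: Hom_def)
  qed simp
next
  assume "is_epi C e"
  then show "exact_from C (Proj C) e (Zero C (Cod C e) Z)"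
    by (auto simp: exact_from_def elim: Proj_lift)
qed

text \<open>The epi \<open>e\<close> is a cokernel of some r, and b r = m e r = 0 forces g r = 0.
  The arrow \<open>m\<close> need not be mono: it is an image inclusion in one application and an
  identity in the other.\<close>

lemma exact_from_factor:
  assumes ab: "exact_from C (Proj C) a b" and e: "is_epi C e" and m: "m \<in> Arr C" "Dom C m = Cod C e"
    and b: "m \<cdot> e = b"
    and g: "g \<in> Hom C (Dom C b) V" "g \<cdot> a = Zero C (Dom C a) V"
  obtains u where "u \<in> Hom C (Cod C e) V" "u \<cdot> e = g"
proof -
  obtain r where r: "is_cokernel C r e"
    using epi_is_cokernel [OF e] by blast
  note R = cokernelD(1-4) [OF r]
  have [simp]: "m \<in> Arr C" "e \<in> Arr C" "Dom C m = Cod C e" "r \<in> Arr C" "Cod C r = Dom C e" "Dom C b = Dom C e"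
    "Cod C b = Cod C m"
    using m e R b by (auto simp: is_epi_def)
  have "(m \<cdot> e) \<cdot> r = m \<cdot> (e \<cdot> r)"
    by (simp add: Comp_assoc_Arr)
  then have "b \<cdot> r = Zero C (Dom C r) (Cod C b)"
    using R b by simp
  then have "g \<cdot> r = Zero C (Dom C r) V"
    by (intro exact_from_cancel [OF ab _ _ g]) (auto simp: Hom_def)
  then show ?thesis
    using cokernelD(5) [OF r, of g V] g that by auto
qed

text \<open>Write b = m e with e epi and m the image inclusion. Arrows out of Dom b that vanish on
  \<open>a\<close> are precisely the composites u e, and u extends along m exactly when u e factors
  through \<open>b\<close>. So the approximation property of Im b is Hom(-, Q)-exactness one place
  earlier, at Dom b.\<close>

lemma left_projective_approximation_image_iff:
  assumes ab: "exact_from C (Proj C) a b"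
  shows "(\<forall>m. is_image C b m \<longrightarrow> left_projective_approximation C m) \<longleftrightarrow>
    Cod C b \<in> Proj C \<and> exact_into C (Proj C) a b"
proof (intro iffI conjI allI impI)
  note A = exact_fromD(1-4) [OF ab]
  assume *: "\<forall>m. is_image C b m \<longrightarrow> left_projective_approximation C m"
  obtain m where m: "is_image C b m"
    using image_exists A by blast
  obtain e where e: "e \<in> Hom C (Dom C b) (Dom C m)" "is_epi C e" "m \<cdot> e = b"
    and mono: "is_mono C m" "Cod C m = Cod C b"
    using image_factor [OF m] by metis
  have [simp]: "e \<in> Arr C" "Dom C e = Dom C b" "Cod C e = Dom C m" "m \<in> Arr C" "a \<in> Arr C" "b \<in> Arr C"
    "Cod C a = Dom C b" "Cod C m = Cod C b"
    using e mono A by (auto simp: Hom_def is_mono_def)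
  show "Cod C b \<in> Proj C"
    using * m mono by (auto simp: left_projective_approximation_def)
  have lpa: "\<forall>Q \<in> Proj C. \<forall>g \<in> Hom C (Dom C m) Q. \<exists>h \<in> Hom C (Cod C m) Q. h \<cdot> m = g"
    using * m unfolding left_projective_approximation_def by blast
  have "\<exists>h \<in> Hom C (Cod C b) Q. h \<cdot> b = g"
    if Q: "Q \<in> Proj C" and g: "g \<in> Hom C (Dom C b) Q" "g \<cdot> a = Zero C (Dom C a) Q" for Q g
  proof -
    obtain u where u: "u \<in> Hom C (Cod C e) Q" "u \<cdot> e = g"
      using exact_from_factor [OF ab e(2) _ _ e(3) g] by auto
    have "u \<in> Hom C (Dom C m) Q"
      using u by simp
    then obtain h where h: "h \<in> Hom C (Cod C m) Q" "h \<cdot> m = u"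
      using bspec [OF bspec [OF lpa Q]] by blast
    have "h \<cdot> (m \<cdot> e) = (h \<cdot> m) \<cdot> e"
      using h(1) by (simp add: Comp_assoc_Arr Hom_def)
    then show ?thesis
      using h u e(3) by auto
  qed
  then show "exact_into C (Proj C) a b"
    using A by (simp add: exact_into_def)
next
  fix m assume *: "Cod C b \<in> Proj C \<and> exact_into C (Proj C) a b" and m: "is_image C b m"
  note A = exact_fromD(1-4) [OF ab]
  obtain e where e: "e \<in> Hom C (Dom C b) (Dom C m)" "is_epi C e" "m \<cdot> e = b"
    and mono: "is_mono C m" "Cod C m = Cod C b"
    using image_factor [OF m] by metis
  have [simp]: "e \<in> Arr C" "Dom C e = Dom C b" "Cod C e = Dom C m" "m \<in> Arr C" "a \<in> Arr C" "b \<in> Arr C"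
    "Cod C a = Dom C b" "Cod C m = Cod C b"
    using e mono A by (auto simp: Hom_def is_mono_def)
  have "m \<cdot> (e \<cdot> a) = Zero C (Dom C a) (Cod C m)"
    using A e(3) by (simp add: Comp_assoc_Arr [symmetric])
  then have ea: "e \<cdot> a = Zero C (Dom C a) (Dom C m)"
    using mono_cancel_zero [OF mono(1), of "e \<cdot> a"] by (simp add: Hom_def)
  have "\<exists>h \<in> Hom C (Cod C m) Q. h \<cdot> m = g" if Q: "Q \<in> Proj C" and g: "g \<in> Hom C (Dom C m) Q" for Q g
  proof -
    have [simp]: "g \<in> Arr C" "Dom C g = Dom C m" "Cod C g = Q" "Q \<in> Obj C"
      using g by (auto simp: Hom_def)
    have "(g \<cdot> e) \<cdot> a = Zero C (Dom C a) Q"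
      using ea by (simp add: Comp_assoc_Arr)
    then obtain h where h: "h \<in> Hom C (Cod C b) Q" "h \<cdot> b = g \<cdot> e"
      using exact_intoD(5) [of "Proj C" a b Q "g \<cdot> e"] * Q by (auto simp: Hom_def)
    have "(h \<cdot> m) \<cdot> e = g \<cdot> e"
      using h e(3) by (simp add: Comp_assoc_Arr Hom_def)
    then have "h \<cdot> m = g"
      by (rule is_epi_cancel [OF e(2), of "h \<cdot> m" Q g, rotated 2]) (use h(1) in \<open>simp_all add: Hom_def\<close>)
    then show ?thesis
      using h(1) by auto
  qed
  then show "left_projective_approximation C m"
    using * by (simp add: left_projective_approximation_def)
qed


lemma exact_into_Zero_left:
  assumes [simp]: "Z \<in> Obj C" "M \<in> Obj C"
  shows "exact_into C S (Zero C Z M) b \<longleftrightarrow> b \<in> Arr C \<and> Dom C b = M \<and>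
    (\<forall>Q \<in> S. \<forall>g \<in> Hom C M Q. \<exists>h \<in> Hom C (Cod C b) Q. h \<cdot> b = g)"
  by (auto simp: exact_into_def Hom_def)

lemma exact_from_Zero_left:
  assumes [simp]: "Z \<in> Obj C" "b \<in> Arr C"
  shows "exact_from C (Proj C) (Zero C Z (Dom C b)) b \<longleftrightarrow> is_mono C b"
proof
  assume ex: "exact_from C (Proj C) (Zero C Z (Dom C b)) b"
  show "is_mono C b"
  proof (rule is_monoI_zero)
    fix W t assume t: "t \<in> Hom C W (Dom C b)" "b \<cdot> t = Zero C W (Cod C b)"
    have "Ident C (Dom C b) \<cdot> t = Zero C W (Dom C b)"
      by (rule exact_from_cancel [OF ex t]) (auto simp: Hom_def)
    then show "t = Zero C W (Dom C b)"
      using t by (simp add: Hom_def)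
  qed simp
next
  assume m: "is_mono C b"
  have "\<exists>h \<in> Hom C W Z. Zero C Z (Dom C b) \<cdot> h = g"
    if "g \<in> Hom C W (Dom C b)" "b \<cdot> g = Zero C W (Cod C b)" for W g
  proof -
    have "W \<in> Obj C"
      using that by (auto simp: Hom_def)
    then show ?thesis
      using mono_cancel_zero [OF m that] by (intro bexI [of _ "Zero C W Z"]) (auto simp: Hom_def)
  qed
  then show "exact_from C (Proj C) (Zero C Z (Dom C b)) b"
    by (simp add: exact_from_def)
qed

section \<open>Torsionfree objects\<close>

lemma torsionfreeD:
  assumes "M \<in> torsionfree C n" and [simp]: "Z \<in> Obj C"
  obtains f where "into_exact_sequence C (Proj C) Z M n f"
    and "\<And>i. i < n \<Longrightarrow> exact_from C (Proj C) (f i) (f (Suc i))"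
proof -
  from assms(1) obtain P f Z' where [simp]: "M \<in> Obj C" and f: "P 0 = M" "zero_object C Z'" "f 0 = Zero C Z' M"
    "\<forall>i \<in> {1..n}. P i \<in> Proj C \<and> f i \<in> Hom C (P (i - 1)) (P i)"
    and ex: "\<forall>i<n. exact_pair C (f i) (f (Suc i))"
    and lpa: "\<forall>i \<in> {1..n}. \<forall>m. is_image C (f i) m \<longrightarrow> left_projective_approximation C m"
    by (auto simp: torsionfree_def)
  have [simp]: "Z' \<in> Obj C"
    using f(2) by (simp add: zero_object_def)
  \<comment> \<open>The zero object in the definition may vary with n, but sequences can only be
    compared if they share their first arrow; hence the change to a fixed \<open>Z\<close>.\<close>
  define g where "g = f(0 := Zero C Z M)"
  have g: "exact_from C (Proj C) (g i) (g (Suc i)) \<and> Cod C (g (Suc i)) \<in> Proj C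
      \<and> exact_into C (Proj C) (g i) (g (Suc i))" if "i < n" for i
  proof -
    have "exact_from C (Proj C) (f i) (f (Suc i))"
      using ex \<open>i < n\<close> by (simp add: exact_pair_iff)
    moreover have "\<forall>m. is_image C (f (Suc i)) m \<longrightarrow> left_projective_approximation C m"
      using lpa \<open>i < n\<close> by auto
    ultimately have *: "exact_from C (Proj C) (f i) (f (Suc i))"
      "Cod C (f (Suc i)) \<in> Proj C" "exact_into C (Proj C) (f i) (f (Suc i))"
      using left_projective_approximation_image_iff by blast+
    show ?thesis
    proof (cases i)
      case 0
      have f1: "f (Suc 0) \<in> Arr C" "Dom C (f (Suc 0)) = M"
        using *(3) 0 f by (auto simp: exact_into_def)
      then have "exact_from C (Proj C) (Zero C Z M) (f (Suc 0))"
        using * 0 f exact_from_Zero_left [of Z "f (Suc 0)"] exact_from_Zero_left [of Z' "f (Suc 0)"]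
        by simp
      then show ?thesis
        using * 0 f by (simp add: g_def exact_into_Zero_left)
    qed (use * in \<open>simp add: g_def\<close>)
  qed
  show ?thesis
    by (rule that [of g]) (use g in \<open>auto simp: into_exact_sequence_def, simp add: g_def\<close>)
qed

lemma torsionfreeI:
  assumes f: "into_exact_sequence C (Proj C) Z M n f" and Z: "zero_object C Z"
    and ex: "\<And>i. i < n \<Longrightarrow> exact_from C (Proj C) (f i) (f (Suc i))"
  shows "M \<in> torsionfree C n"
proof -
  have f': "f 0 = Zero C Z M" "M \<in> Obj C" "Z \<in> Obj C"
    "\<And>i. i < n \<Longrightarrow> exact_into C (Proj C) (f i) (f (Suc i)) \<and> Cod C (f (Suc i)) \<in> Proj C"
    using f by (auto simp: into_exact_sequence_def)
  define P where "P i = Cod C (f i)" for i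
  have "P i \<in> Proj C \<and> f i \<in> Hom C (P (i - 1)) (P i) \<and>
      (\<forall>m. is_image C (f i) m \<longrightarrow> left_projective_approximation C m)" if i: "i \<in> {1..n}" for i
  proof -
    obtain j where j: "i = Suc j" "j < n"
      using i by (cases i) auto
    show ?thesis
      using f'(4) [OF j(2)] exact_intoD(2,3) [of "Proj C" "f j" "f (Suc j)"]
        left_projective_approximation_image_iff [OF ex [OF j(2)]] j(1)
      by (auto simp: P_def Hom_def)
  qed
  moreover have "P 0 = M"
    using f' by (simp add: P_def)
  ultimately show ?thesis
    unfolding torsionfree_def using f' Z ex exact_pair_iff
    by (auto intro!: exI [of _ P] exI [of _ f] exI [of _ Z])
qed

lemma infinitely_torsionfree_iff:
  assumes Z: "zero_object C Z" and M: "M \<in> Obj C"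
  shows "M \<in> infinitely_torsionfree C \<longleftrightarrow>
    (\<exists>f. f 0 = Zero C Z M \<and> (\<forall>i. exact_into C (Proj C) (f i) (f (Suc i)) \<and>
      exact_from C (Proj C) (f i) (f (Suc i)) \<and> Cod C (f (Suc i)) \<in> Proj C))"
proof
  have ZO: "Z \<in> Obj C"
    using Z by (simp add: zero_object_def)
  assume "M \<in> infinitely_torsionfree C"
  then have tf: "M \<in> torsionfree C (Suc n)" for n
    by (simp add: infinitely_torsionfree_def)
  have "\<exists>f. into_exact_sequence C (Proj C) Z M n f" for n
  proof -
    obtain f where "into_exact_sequence C (Proj C) Z M (Suc n) f"
      using torsionfreeD [OF tf ZO] by metis
    then show ?thesis
      by (auto simp: into_exact_sequence_def)
  qed
  then obtain f where f: "\<And>n. into_exact_sequence C (Proj C) Z M n f"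
    using infinite_into_exact_sequence by blast
  \<comment> \<open>\<open>f\<close> was built for Hom(-, Q)-exactness alone. Its ordinary exactness
    at position \<open>i\<close> is transferred from a given sequence of length
    \<open>Suc i\<close>.\<close>
  have "exact_from C (Proj C) (f i) (f (Suc i))" for i
  proof -
    obtain f' where f': "into_exact_sequence C (Proj C) Z M (Suc i) f'"
      "exact_from C (Proj C) (f' i) (f' (Suc i))"
      using torsionfreeD [OF tf [of i] ZO] by (metis lessI)
    show ?thesis
      by (rule into_exact_sequence_exact_from [OF f f'(1) _ f'(2)]) simp
  qed
  then show "\<exists>f. f 0 = Zero C Z M \<and> (\<forall>i. exact_into C (Proj C) (f i) (f (Suc i)) \<and>
      exact_from C (Proj C) (f i) (f (Suc i)) \<and> Cod C (f (Suc i)) \<in> Proj C)"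
    using f unfolding into_exact_sequence_def by (metis lessI)
next
  assume "\<exists>f. f 0 = Zero C Z M \<and> (\<forall>i. exact_into C (Proj C) (f i) (f (Suc i)) \<and>
      exact_from C (Proj C) (f i) (f (Suc i)) \<and> Cod C (f (Suc i)) \<in> Proj C)"
  then obtain f where f: "f 0 = Zero C Z M" "\<And>i. exact_into C (Proj C) (f i) (f (Suc i)) \<and>
      exact_from C (Proj C) (f i) (f (Suc i)) \<and> Cod C (f (Suc i)) \<in> Proj C"
    by blast
  have "into_exact_sequence C (Proj C) Z M n f" for n
    using f M Z by (simp add: into_exact_sequence_def zero_object_def)
  then show "M \<in> infinitely_torsionfree C"
    unfolding infinitely_torsionfree_def using f torsionfreeI [OF _ Z] by blast
qed

text \<open>Exactness already matches each codomain with the next domain, so only domains have to be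
  compared with \<open>Q\<close>; exactness at \<open>M\<close> becomes the statement that the
  augmentation is epi.\<close>

lemma projective_resolution_iff:
  assumes Z: "zero_object C Z" and M: "M \<in> Obj C"
  shows "projective_resolution C M Q d \<longleftrightarrow> d 0 \<in> Arr C \<and> Cod C (d 0) = M \<and> is_epi C (d 0) \<and>
    (\<forall>n. Dom C (d n) = Q n \<and> Q n \<in> Proj C \<and> exact_from C (Proj C) (d (Suc n)) (d n))"
proof -
  have epi: "(\<exists>Z. zero_object C Z \<and> exact_pair C (d 0) (Zero C M Z)) \<longleftrightarrow> is_epi C (d 0)"
    if "d 0 \<in> Hom C (Q 0) M"
    using that Z exact_from_Zero_iff [of _ "d 0"]
    by (auto simp: exact_pair_iff Hom_def zero_object_def)
  have Hom: "(\<forall>n. d (Suc n) \<in> Hom C (Q (Suc n)) (Q n)) \<longleftrightarrow> (\<forall>n. Dom C (d (Suc n)) = Q (Suc n))"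
    if "d 0 \<in> Hom C (Q 0) M" "\<forall>n. exact_from C (Proj C) (d (Suc n)) (d n)"
  proof -
    have A: "d (Suc n) \<in> Arr C \<and> Cod C (d (Suc n)) = Dom C (d n)" for n
      using that by (auto simp: exact_from_def)
    show ?thesis
    proof (intro iffI allI)
      fix n assume "\<forall>n. Dom C (d (Suc n)) = Q (Suc n)"
      then have "Dom C (d m) = Q m" for m
        using that(1) by (cases m) (auto simp: Hom_def)
      then show "d (Suc n) \<in> Hom C (Q (Suc n)) (Q n)"
        using A by (simp add: Hom_def)
    qed (simp add: Hom_def)
  qed
  have all: "(\<forall>n. Dom C (d n) = Q n) \<longleftrightarrow> Dom C (d 0) = Q 0 \<and> (\<forall>n. Dom C (d (Suc n)) = Q (Suc n))"
    by (metis not0_implies_Suc)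
  have H0: "d 0 \<in> Hom C (Q 0) M \<longleftrightarrow> d 0 \<in> Arr C \<and> Cod C (d 0) = M \<and> Dom C (d 0) = Q 0"
    by (auto simp: Hom_def)
  show ?thesis
    unfolding projective_resolution_def exact_pair_iff [symmetric]
    using epi Hom all H0 by (auto simp: exact_pair_iff)
qed

lemma projective_resolution_exists:
  assumes "M \<in> Obj C"
  obtains Q d where "projective_resolution C M Q d"
proof -
  obtain Z where Z: "zero_object C Z"
    using zero_object_exists by blast
  obtain P e where e: "P \<in> Proj C" "is_epi C e" "e \<in> Arr C" "Dom C e = P" "Cod C e = M"
    using projective_cover [OF assms] by metis
  \<comment> \<open>The next differential is a projective cover map onto the kernel of
    \<open>a\<close>, followed by the kernel inclusion ("cover" meaning any epi from a
    projective).\<close>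
  have "\<exists>b. (b \<in> Arr C \<and> Dom C b \<in> Proj C) \<and> exact_from C (Proj C) b a" if a: "a \<in> Arr C \<and> Dom C a \<in> Proj C" for a
  proof -
    obtain k where k: "is_kernel C a k"
      using kernel_exists a by blast
    note K = kernelD(1-4) [OF k]
    obtain P p where p: "P \<in> Proj C" "is_epi C p" and [simp]: "p \<in> Arr C" "Dom C p = P" "Cod C p = Dom C k" "P \<in> Obj C"
      using projective_cover [of "Dom C k"] K by auto
    have [simp]: "a \<in> Arr C" "k \<in> Arr C" "Cod C k = Dom C a"
      using K by auto
    have "\<exists>h \<in> Hom C W P. (k \<cdot> p) \<cdot> h = g"
      if W: "W \<in> Proj C" and g: "g \<in> Hom C W (Dom C a)" "a \<cdot> g = Zero C W (Cod C a)" for W g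
    proof -
      obtain u where u: "u \<in> Hom C W (Dom C k)" "k \<cdot> u = g"
        using kernelD(5) [OF k g] by auto
      obtain h where h: "h \<in> Hom C W P" "p \<cdot> h = u"
        using Proj_lift [OF W p(2), of u] u by auto
      then show ?thesis
        using u by (intro bexI [of _ h]) (auto simp: Comp_assoc_Arr Hom_def)
    qed
    moreover have "a \<cdot> (k \<cdot> p) = Zero C P (Cod C a)"
      using K by (simp add: Comp_assoc_Arr [symmetric])
    ultimately have "exact_from C (Proj C) (k \<cdot> p) a"
      by (simp add: exact_from_def)
    then show ?thesis
      using p by (intro exI [of _ "k \<cdot> p"]) simp
  qed
  then obtain d where d: "\<forall>n. ((d n \<in> Arr C \<and> Dom C (d n) \<in> Proj C) \<and> (n = 0 \<longrightarrow> d n = e))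
      \<and> exact_from C (Proj C) (d (Suc n)) (d n)"
    using e dependent_nat_choice [of "\<lambda>n a. (a \<in> Arr C \<and> Dom C a \<in> Proj C) \<and> (n = 0 \<longrightarrow> a = e)"
        "\<lambda>_ a b. exact_from C (Proj C) b a"] by (metis Suc_neq_Zero)
  then have "projective_resolution C M (\<lambda>n. Dom C (d n)) d"
    using e by (auto simp: projective_resolution_iff [OF Z assms])
  then show ?thesis
    using that by blast
qed

end

section \<open>Vanishing of Ext\<close>

lemma (in comm_group) trivial_FactGroup_iff:
  assumes "subgroup H G"
  shows "trivial_group (G Mod H) \<longleftrightarrow> carrier G \<subseteq> H"
proof -
  have "H #> x = H \<longleftrightarrow> x \<in> H" if "x \<in> carrier G" for x
    using coset_join1 [of H x] coset_join2 [of x H] assms that subgroup.subset by blast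
  moreover have "group (G Mod H)"
    using subgroup_imp_normal [OF assms] normal.factorgroup_is_group by blast
  ultimately show ?thesis
    by (auto simp: group.trivial_group_subset carrier_FactGroup)
qed

text \<open>Positive degree n + 1 is cohomology at Q (n + 1), between the differentials with indices
  n + 2 and n + 1, and it vanishes when all cocycles are coboundaries.\<close>

lemma (in preadditive_category) trivial_group_Ext_via_Suc:
  assumes [simp]: "Y \<in> Obj C" and ab: "d (Suc (Suc n)) \<in> Hom C (Q (Suc (Suc n))) (Q (Suc n))"
      "d (Suc n) \<in> Hom C (Q (Suc n)) (Q n)"
    and zero: "d (Suc n) \<cdot> d (Suc (Suc n)) = Zero C (Q (Suc (Suc n))) (Q n)"
  shows "trivial_group (Ext_via C Q d (Suc n) Y) \<longleftrightarrow> exact_into C {Y} (d (Suc (Suc n))) (d (Suc n))"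
proof -
  have [simp]: "d (Suc (Suc n)) \<in> Arr C" "Dom C (d (Suc (Suc n))) = Q (Suc (Suc n))"
    "Cod C (d (Suc (Suc n))) = Q (Suc n)" "d (Suc n) \<in> Arr C" "Dom C (d (Suc n)) = Q (Suc n)"
    "Cod C (d (Suc n)) = Q n"
    using ab by (auto simp: Hom_def)
  have [simp]: "Q n \<in> Obj C" "Q (Suc n) \<in> Obj C" "Q (Suc (Suc n)) \<in> Obj C"
    using Cod_Obj [of "d (Suc n)"] Dom_Obj [of "d (Suc n)"] Dom_Obj [of "d (Suc (Suc n))"] by simp_all
  let ?G = "hom_group C (Q (Suc n)) Y"
  interpret G: comm_group ?G
    by (rule comm_group_hom_group) auto
  let ?Z = "Ext_cocycles C Q d (Suc n) Y" and ?B = "Ext_coboundaries C Q d (Suc n) Y"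
  have Z: "?Z = {g \<in> Hom C (Q (Suc n)) Y. g \<cdot> d (Suc (Suc n)) = Zero C (Q (Suc (Suc n))) Y}"
    by (simp add: Ext_cocycles_def kernel_def hom_group_def)
  have H: "group_hom ?G (hom_group C (Q (Suc (Suc n))) Y) (\<lambda>g. g \<cdot> d (Suc (Suc n)))"
    by (intro group_hom.intro group_hom_axioms.intro homI comm_group.axioms(2) comm_group_hom_group)
      (auto simp: hom_group_def Hom_def Add_Comp_Arr)
  have subZ: "subgroup ?Z ?G"
    using group_hom.subgroup_kernel [OF H] by (simp add: Ext_cocycles_def)
  \<comment> \<open>The quotient is taken inside the cocycles. They must be a commutative group,
    with the coboundaries as a subgroup, before triviality of the quotient can be read as an
    inclusion.\<close>
  interpret Z: comm_group "?G\<lparr>carrier := ?Z\<rparr>"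
    using G.m_comm subgroup.subset [OF subZ]
    by (intro group.group_comm_groupI subgroup.subgroup_is_group [OF subZ] G.is_group) auto
  have H': "group_hom (hom_group C (Q n) Y) (?G\<lparr>carrier := ?Z\<rparr>) (\<lambda>g. g \<cdot> d (Suc n))"
    by (intro group_hom.intro group_hom_axioms.intro homI comm_group.axioms(2) comm_group_hom_group
        Z.comm_group_axioms) (auto simp: hom_group_def Hom_def Add_Comp_Arr Z Comp_assoc_Arr zero)
  have subB: "subgroup ?B (?G\<lparr>carrier := ?Z\<rparr>)"
    using group_hom.img_is_subgroup [OF H'] by (simp add: hom_group_def)
  have "trivial_group (Ext_via C Q d (Suc n) Y) \<longleftrightarrow> ?Z \<subseteq> ?B"
    using Z.trivial_FactGroup_iff [OF subB] by (simp add: Ext_via_def)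
  also have "\<dots> \<longleftrightarrow> exact_into C {Y} (d (Suc (Suc n))) (d (Suc n))"
    by (auto simp: exact_into_def Z zero)
  finally show ?thesis .
qed


context abelian_category_enough_projectives
begin

text \<open>This is left exactness of Hom(-, V). It settles the position at the augmentation, about
  which the vanishing of Ext in positive degrees says nothing.\<close>

lemma exact_into_epi:
  assumes ab: "exact_from C (Proj C) a b" and e: "is_epi C b"
  shows "exact_into C S a b"
proof -
  note A = exact_fromD(1-4) [OF ab]
  have "\<exists>h \<in> Hom C (Cod C b) V. h \<cdot> b = g"
    if g: "g \<in> Hom C (Dom C b) V" "g \<cdot> a = Zero C (Dom C a) V" for V g
    using exact_from_factor [OF ab e, of "Ident C (Cod C b)", OF _ _ _ g] A by auto
  then show ?thesis
    using A by (simp add: exact_into_def)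
qed

text \<open>In the opposite category the roles change: being a resolution is the property that
  yields the comparison maps, and exactness under Hom(-, Y) for Y in \<open>S\<close> is the
  property that is transferred.\<close>

lemma projective_resolution_exact_into:
  assumes "projective_resolution C M Q d" "projective_resolution C M Q' d'" "M \<in> Obj C"
    and "exact_into C S (d' (Suc n)) (d' n)"
  shows "exact_into C S (d (Suc n)) (d n)"
proof -
  obtain Z where Z: "zero_object C Z"
    using zero_object_exists by blast
  interpret op: preadditive_category "opposite C"
    by (rule preadditive_category_opposite)
  \<comment> \<open>The arrow from \<open>M\<close> to \<open>Z\<close> goes in front, so
    \<open>d n\<close> sits at position \<open>Suc n\<close>.\<close>
  have seq: "into_exact_sequence (opposite C) (Proj C) Z M k (case_nat (Zero C M Z) d)"
    if d: "projective_resolution C M Q d" for k Q d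
  proof -
    note D = d [unfolded projective_resolution_iff [OF Z \<open>M \<in> Obj C\<close>]]
    have "exact_into (opposite C) (Proj C) (case_nat (Zero C M Z) d i) (case_nat (Zero C M Z) d (Suc i))" for i
      using D exact_from_Zero_iff [of Z "d 0"] Z
      by (cases i) (auto simp: exact_opposite zero_object_def)
    then show ?thesis
      using D Z \<open>M \<in> Obj C\<close> by (auto simp: into_exact_sequence_def zero_object_def)
  qed
  show ?thesis
    using op.into_exact_sequence_exact_from [OF seq [OF assms(1)] seq [OF assms(2)], of "Suc n" "Suc (Suc n)" S]
      assms(4) by (simp add: exact_opposite)
qed

lemma Ext_trivial_iff:
  assumes d: "projective_resolution C M Q d" and M: "M \<in> Obj C"
  shows "(\<forall>i \<ge> 1. \<forall>P \<in> Proj C. trivial_group (Ext C i M P)) \<longleftrightarrow>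
    (\<forall>n. exact_into C (Proj C) (d (Suc n)) (d n))"
proof -
  obtain Z where Z: "zero_object C Z"
    using zero_object_exists by blast
  obtain Q' d' where chosen: "(SOME (Q, d). projective_resolution C M Q d) = (Q', d')"
    by fastforce
  have d': "projective_resolution C M Q' d'"
    \<comment> \<open>The given resolution guarantees that the arbitrary choice inside
      \<open>Ext\<close> is a resolution; at the end of the chain it is exchanged for the given
      one.\<close>
    using someI [of "\<lambda>(Q, d). projective_resolution C M Q d" "(Q, d)"] d chosen by simp
  note D = d' [unfolded projective_resolution_iff [OF Z M]]
  have *: "trivial_group (Ext C (Suc n) M P) \<longleftrightarrow> exact_into C {P} (d' (Suc (Suc n))) (d' (Suc n))"
    if P: "P \<in> Proj C" for n P
  proof -
    have "exact_from C (Proj C) (d' (Suc (Suc n))) (d' (Suc n))" "exact_from C (Proj C) (d' (Suc n)) (d' n)"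
      "\<And>n. Dom C (d' n) = Q' n"
      using D by auto
    then show ?thesis
      unfolding Ext_def chosen prod.case
      by (intro trivial_group_Ext_via_Suc Proj_Obj [OF P]) (auto simp: exact_from_def Hom_def)
  qed
  have 0: "exact_into C S (d' (Suc 0)) (d' 0)" for S
    using D by (intro exact_into_epi) auto
  have "(\<forall>i \<ge> 1. \<forall>P \<in> Proj C. trivial_group (Ext C i M P)) \<longleftrightarrow>
      (\<forall>n. \<forall>P \<in> Proj C. exact_into C {P} (d' (Suc (Suc n))) (d' (Suc n)))"
    using * by (metis One_nat_def Suc_le_D le_add1 plus_1_eq_Suc)
  also have "\<dots> \<longleftrightarrow> (\<forall>n. exact_into C (Proj C) (d' (Suc (Suc n))) (d' (Suc n)))"
  proof -
    have "d' (Suc (Suc n)) \<in> Arr C \<and> d' (Suc n) \<in> Arr C \<and> Cod C (d' (Suc (Suc n))) = Dom C (d' (Suc n)) \<and>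
      d' (Suc n) \<cdot> d' (Suc (Suc n)) = Zero C (Dom C (d' (Suc (Suc n)))) (Cod C (d' (Suc n)))" for n
      using D exact_fromD(1-4) by blast
    then show ?thesis
      by (simp add: exact_into_def)
  qed
  also have "\<dots> \<longleftrightarrow> (\<forall>n. exact_into C (Proj C) (d' (Suc n)) (d' n))"
    using 0 by (metis not0_implies_Suc)
  also have "\<dots> \<longleftrightarrow> (\<forall>n. exact_into C (Proj C) (d (Suc n)) (d n))"
    using projective_resolution_exact_into [OF d d' M] projective_resolution_exact_into [OF d' d M] by blast
  finally show ?thesis .
qed

end

section \<open>Splicing\<close>

context preadditive_category
begin

text \<open>This lemma, \<open>exact_from_Comp_iff\<close> and their duals describe both kinds of
  exactness on either side of a composite k e of an epi and a mono. Being equivalences, they serve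
  both to splice a complex and to cut it.\<close>

lemma exact_from_Comp_mono:
  assumes k: "is_mono C k" and [simp]: "e \<in> Arr C" "Cod C e = Dom C k"
  shows "exact_from C S a (k \<cdot> e) \<longleftrightarrow> exact_from C S a e"
proof -
  have [simp]: "k \<in> Arr C"
    using k by (simp add: is_mono_def)
  have "(k \<cdot> e) \<cdot> g = Zero C W (Cod C k) \<longleftrightarrow> e \<cdot> g = Zero C W (Dom C k)" if "g \<in> Hom C W (Dom C e)" for g W
  proof -
    have [simp]: "g \<in> Arr C" "Dom C g = W" "Cod C g = Dom C e" "W \<in> Obj C"
      using that by (auto simp: Hom_def)
    show ?thesis
      using mono_cancel_zero [OF k, of "e \<cdot> g" W] by (auto simp: Comp_assoc_Arr Hom_def)
  qed
  then show ?thesis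
    by (auto simp: exact_from_def Hom_def)
qed

lemma exact_into_Comp_epi:
  assumes e: "is_epi C e" and "k \<in> Arr C" "Cod C e = Dom C k"
  shows "exact_into C S (k \<cdot> e) c \<longleftrightarrow> exact_into C S k c"
proof -
  interpret op: preadditive_category "opposite C"
    by (rule preadditive_category_opposite)
  show ?thesis
    using op.exact_from_Comp_mono [of e k S c] assms
    by (simp add: is_epi_opposite exact_opposite is_epi_def is_mono_def)
qed

text \<open>Every arrow that \<open>c\<close> kills lifts through k, and such lifts must lift
  further through e. Exactness of e before a zero arrow encodes that Hom(W, e) is onto for W in
  \<open>S\<close>.\<close>

lemma exact_from_Comp_iff:
  assumes k: "is_mono C k" and [simp]: "e \<in> Arr C" "Cod C e = Dom C k" "Z \<in> Obj C"
    and c [simp]: "c \<in> Arr C" "Cod C k = Dom C c" and ck: "c \<cdot> k = Zero C (Dom C k) (Cod C c)"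
  shows "exact_from C S (k \<cdot> e) c \<longleftrightarrow> exact_from C S k c \<and> exact_from C S e (Zero C (Cod C e) Z)"
proof (intro iffI conjI)
  have [simp]: "k \<in> Arr C"
    using k by (simp add: is_mono_def)
  assume ex: "exact_from C S (k \<cdot> e) c"
  have "\<exists>h \<in> Hom C W (Dom C k). k \<cdot> h = g"
    if W: "W \<in> S" and g: "g \<in> Hom C W (Dom C c)" "c \<cdot> g = Zero C W (Cod C c)" for W g
  proof -
    obtain h where h: "h \<in> Hom C W (Dom C e)" "(k \<cdot> e) \<cdot> h = g"
      using exact_fromD(5) [OF ex W g] by auto
    then show ?thesis
      by (intro bexI [of _ "e \<cdot> h"]) (auto simp: Hom_def Comp_assoc_Arr)
  qed
  then show "exact_from C S k c"
    using ck by (simp add: exact_from_def)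
  have "\<exists>h \<in> Hom C W (Dom C e). e \<cdot> h = g" if W: "W \<in> S" and g: "g \<in> Hom C W (Dom C k)" for W g
  proof -
    have [simp]: "g \<in> Arr C" "Dom C g = W" "Cod C g = Dom C k" "W \<in> Obj C"
      using g by (auto simp: Hom_def)
    have "c \<cdot> (k \<cdot> g) = Zero C W (Cod C c)"
      using ck by (simp add: Comp_assoc_Arr [symmetric])
    then obtain h where h: "h \<in> Hom C W (Dom C e)" "(k \<cdot> e) \<cdot> h = k \<cdot> g"
      using exact_fromD(5) [OF ex W, of "k \<cdot> g"] by (auto simp: Hom_def)
    then have "e \<cdot> h = g"
      using is_mono_cancel [OF k, of "e \<cdot> h" W g] by (auto simp: Hom_def Comp_assoc_Arr)
    then show ?thesis
      using h by auto
  qed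
  then show "exact_from C S e (Zero C (Cod C e) Z)"
    by (simp add: exact_from_def)
next
  have [simp]: "k \<in> Arr C"
    using k by (simp add: is_mono_def)
  assume ex: "exact_from C S k c \<and> exact_from C S e (Zero C (Cod C e) Z)"
  have "\<exists>h \<in> Hom C W (Dom C e). (k \<cdot> e) \<cdot> h = g"
    if W: "W \<in> S" and g: "g \<in> Hom C W (Dom C c)" "c \<cdot> g = Zero C W (Cod C c)" for W g
  proof -
    obtain u where u: "u \<in> Hom C W (Dom C k)" "k \<cdot> u = g"
      using exact_fromD(5) [of S k c W g] ex W g by auto
    then obtain h where h: "h \<in> Hom C W (Dom C e)" "e \<cdot> h = u"
      using exact_fromD(5) [of S e "Zero C (Cod C e) Z" W u] ex W by (auto simp: Hom_def)
    then show ?thesis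
      using u by (intro bexI [of _ h]) (auto simp: Hom_def Comp_assoc_Arr)
  qed
  then show "exact_from C S (k \<cdot> e) c"
    using ck by (simp add: exact_from_def Comp_assoc_Arr [symmetric])
qed

lemma exact_into_Comp_iff:
  assumes "is_epi C e" "k \<in> Arr C" "Cod C e = Dom C k" "Z \<in> Obj C"
    and "a \<in> Arr C" "Cod C a = Dom C e" "e \<cdot> a = Zero C (Dom C a) (Cod C e)"
  shows "exact_into C S a (k \<cdot> e) \<longleftrightarrow> exact_into C S a e \<and> exact_into C S (Zero C Z (Dom C k)) k"
proof -
  interpret op: preadditive_category "opposite C"
    by (rule preadditive_category_opposite)
  show ?thesis
    using op.exact_from_Comp_iff [of e k Z a S] assms
    by (simp add: is_epi_opposite exact_opposite is_epi_def is_mono_def)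
qed

end

section \<open>Totally acyclic complexes and Gorenstein projective objects\<close>

context abelian_category_enough_projectives
begin

lemma totally_acyclic_iff:
  "totally_acyclic C X d \<longleftrightarrow> (\<forall>i. Dom C (d i) = X i \<and> X i \<in> Proj C \<and>
    exact_from C (Proj C) (d i) (d (i + 1)) \<and> exact_into C (Proj C) (d i) (d (i + 1)))"
proof -
  \<comment> \<open>The definition speaks of degree i + 2, whereas the codomain of
    \<open>d (i + 1)\<close> first appears as (i + 1) + 1.\<close>
  have two: "X (i + 1 + 1) = X (i + 2)" for i
    by (simp add: add.assoc)
  have "exact_into C (Proj C) (d i) (d (i + 1)) \<longleftrightarrow> (\<forall>P \<in> Proj C.
      (\<lambda>h. h \<cdot> d (i + 1)) ` carrier (hom_group C (X (i + 2)) P) =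
        kernel (hom_group C (X (i + 1)) P) (hom_group C (X i) P) (\<lambda>g. g \<cdot> d i))"
    if d: "\<And>i. d i \<in> Hom C (X i) (X (i + 1))"
      and dd: "\<And>i. d (i + 1) \<cdot> d i = Zero C (X i) (X (i + 2))" for i
  proof -
    have [simp]: "d i \<in> Arr C" "Dom C (d i) = X i" "X i \<in> Obj C" for i
      using d [of i] Dom_Obj [of "d i"] by (auto simp: Hom_def)
    have [simp]: "Cod C (d i) = X (i + 1)" "Cod C (d (i + 1)) = X (i + 2)"
      using d [of i] d [of "i + 1"] unfolding two by (auto simp only: Hom_def mem_Collect_eq)
    have sub: "(h \<cdot> d (i + 1)) \<cdot> d i = Zero C (X i) P \<and> h \<cdot> d (i + 1) \<in> Hom C (X (i + 1)) P"
      if "h \<in> Hom C (X (i + 2)) P" for h P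
    proof -
      have "h \<in> Arr C" "Dom C h = X (i + 2)" "Cod C h = P" "P \<in> Obj C"
        using that by (auto simp: Hom_def)
      then show ?thesis
        by (simp add: Hom_def Comp_assoc_Arr dd)
    qed
    have "exact_into C (Proj C) (d i) (d (i + 1)) \<longleftrightarrow> (\<forall>P \<in> Proj C. \<forall>g \<in> Hom C (X (i + 1)) P.
        g \<cdot> d i = Zero C (X i) P \<longrightarrow> (\<exists>h \<in> Hom C (X (i + 2)) P. h \<cdot> d (i + 1) = g))"
      by (simp add: exact_into_def dd)
    also have "\<dots> \<longleftrightarrow> (\<forall>P \<in> Proj C. (\<lambda>h. h \<cdot> d (i + 1)) ` Hom C (X (i + 2)) P =
        {g \<in> Hom C (X (i + 1)) P. g \<cdot> d i = Zero C (X i) P})"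
    proof (intro ball_cong refl)
      fix P
      let ?I = "(\<lambda>h. h \<cdot> d (i + 1)) ` Hom C (X (i + 2)) P"
      let ?K = "{g \<in> Hom C (X (i + 1)) P. g \<cdot> d i = Zero C (X i) P}"
      have "?I \<subseteq> ?K"
        using sub by auto
      \<comment> \<open>Images lie in kernels because consecutive differentials compose to zero;
        exactness is the other inclusion.\<close>
      then have "?I = ?K \<longleftrightarrow> ?K \<subseteq> ?I"
        by blast
      then show "(\<forall>g \<in> Hom C (X (i + 1)) P. g \<cdot> d i = Zero C (X i) P \<longrightarrow>
          (\<exists>h \<in> Hom C (X (i + 2)) P. h \<cdot> d (i + 1) = g)) \<longleftrightarrow> ?I = ?K"
        by (simp add: subset_iff image_iff) metis
    qed
    finally show ?thesis
      by (simp add: hom_group_def kernel_def)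
  qed
  note into = this
  show ?thesis
  proof
    assume ta: "totally_acyclic C X d"
    then have d: "d i \<in> Hom C (X i) (X (i + 1))"
      and dd: "d (i + 1) \<cdot> d i = Zero C (X i) (X (i + 2))"
      and ex: "X i \<in> Proj C \<and> exact_from C (Proj C) (d i) (d (i + 1))" for i
      unfolding totally_acyclic_def acyclic_complex_def exact_pair_iff by blast+
    have "exact_into C (Proj C) (d i) (d (i + 1))" for i
      using ta unfolding into [OF d dd] totally_acyclic_def by blast
    moreover have "Dom C (d i) = X i" for i
      using d [of i] by (auto simp: Hom_def)
    ultimately show "\<forall>i. Dom C (d i) = X i \<and> X i \<in> Proj C \<and>
        exact_from C (Proj C) (d i) (d (i + 1)) \<and> exact_into C (Proj C) (d i) (d (i + 1))"
      using ex by blast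
  next
    assume *: "\<forall>i. Dom C (d i) = X i \<and> X i \<in> Proj C \<and>
        exact_from C (Proj C) (d i) (d (i + 1)) \<and> exact_into C (Proj C) (d i) (d (i + 1))"
    have d: "d i \<in> Hom C (X i) (X (i + 1))" for i
      using exact_fromD(1,3) [of "Proj C" "d i" "d (i + 1)"] spec [OF *, of i] spec [OF *, of "i + 1"]
      by (simp add: Hom_def)
    have dd: "d (i + 1) \<cdot> d i = Zero C (X i) (X (i + 2))" for i
    proof -
      have "Cod C (d (i + 1)) = X (i + 2)"
        using d [of "i + 1"] unfolding two by (simp only: Hom_def mem_Collect_eq)
      then show ?thesis
        using exact_fromD(4) [of "Proj C" "d i" "d (i + 1)"] spec [OF *, of i] by simp
    qed
    have "\<forall>P \<in> Proj C. (\<lambda>h. h \<cdot> d (i + 1)) ` carrier (hom_group C (X (i + 2)) P) =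
        kernel (hom_group C (X (i + 1)) P) (hom_group C (X i) P) (\<lambda>g. g \<cdot> d i)" for i
      using * into [OF d dd] by blast
    moreover have "X i \<in> Obj C" "X i \<in> Proj C" "exact_from C (Proj C) (d i) (d (i + 1))" for i
      using * Proj_Obj by blast+
    ultimately show "totally_acyclic C X d"
      using d dd by (simp only: totally_acyclic_def acyclic_complex_def exact_pair_iff) blast
  qed
qed


lemma Gorenstein_projectiveI:
  assumes Z: "zero_object C Z" and M: "M \<in> Obj C"
    and d: "projective_resolution C M Q d" and d_into: "\<And>n. exact_into C (Proj C) (d (Suc n)) (d n)"
    and f0: "f 0 = Zero C Z M" and f: "\<And>i. exact_into C (Proj C) (f i) (f (Suc i))"
      "\<And>i. exact_from C (Proj C) (f i) (f (Suc i))" "\<And>i. Cod C (f (Suc i)) \<in> Proj C"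
  shows "Gorenstein_projective C M"
proof -
  have [simp]: "Z \<in> Obj C" "M \<in> Obj C"
    using Z M by (auto simp: zero_object_def)
  note D = d [unfolded projective_resolution_iff [OF Z M]]
  let ?k = "f (Suc 0)" and ?e = "d 0" and ?g = "f (Suc (Suc 0))"
  have fi: "f i \<in> Arr C" "Cod C (f i) = Dom C (f (Suc i))" for i
    using exact_intoD(1,3) [OF f(1)] by auto
  have k: "?k \<in> Arr C" "Dom C ?k = M" "Cod C ?k = Dom C ?g"
    using fi(1) fi(2) [of 0] fi(2) [of "Suc 0"] by (auto simp: f0)
  have kZ: "exact_into C (Proj C) (Zero C Z M) ?k" and mono: "is_mono C ?k"
    using f(1) [of 0] f(2) [of 0] exact_from_Zero_left [of Z ?k] k by (simp_all add: f0)
  have e: "?e \<in> Arr C" "Cod C ?e = M" "is_epi C ?e"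
    using D by auto
  have d1: "d (Suc 0) \<in> Arr C" "Cod C (d (Suc 0)) = Dom C ?e" "?e \<cdot> d (Suc 0) = Zero C (Dom C (d (Suc 0))) M"
    using exact_intoD(1,3,4) [OF d_into [of 0]] e by auto
  have ker: "is_kernel C ?g ?k"
  proof (rule is_kernelI)
    note ex = f(2) [of "Suc 0"]
    show "?g \<cdot> ?k = Zero C (Dom C ?k) (Cod C ?g)"
      using exact_fromD(4) [OF ex] .
    fix W h assume h: "h \<in> Hom C W (Dom C ?g)" "?g \<cdot> h = Zero C W (Cod C ?g)"
    \<comment> \<open>Lifts through \<open>?k\<close> are available only from projectives. For
      general \<open>W\<close>, the mono \<open>?k\<close> is a kernel of some c, and c h = 0
      follows by cancellation.\<close>
    obtain c where c: "is_kernel C c ?k"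
      using mono_is_kernel [OF mono] by blast
    note L = kernelD(1,3,4) [OF c]
    have "c \<cdot> h = Zero C W (Cod C c)"
      by (rule exact_from_cancel [OF ex h]) (use L k in \<open>auto simp: Hom_def\<close>)
    then show "\<exists>u \<in> Hom C W (Dom C ?k). ?k \<cdot> u = h"
      using kernelD(5) [OF c, of h W] h L k by auto
  qed (use fi mono k in auto)
  \<comment> \<open>The arrows \<open>f 1\<close> and \<open>d 0\<close> are absorbed into the
    composite in degree -1. So \<open>f\<close> starts at index 2 in degree 0, which makes
    \<open>M\<close> the zeroth cocycle, and \<open>d n\<close> with n > 0 sits in degree -1 -
    n.\<close>
  define \<delta> where "\<delta> i = (if i \<ge> 0 then f (Suc (Suc (nat i))) else if i = -1 then ?k \<cdot> ?e
    else d (nat (- 1 - i)))" for i :: int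
  have splice: "exact_from C (Proj C) (?k \<cdot> ?e) ?g" "exact_into C (Proj C) (?k \<cdot> ?e) ?g"
    "exact_from C (Proj C) (d (Suc 0)) (?k \<cdot> ?e)" "exact_into C (Proj C) (d (Suc 0)) (?k \<cdot> ?e)"
  proof -
    show "exact_from C (Proj C) (?k \<cdot> ?e) ?g"
      using exact_from_Comp_iff [OF mono e(1), of Z ?g "Proj C"] exact_from_Zero_iff [of Z ?e]
        exact_fromD(4) [OF f(2) [of "Suc 0"]] f(2) [of "Suc 0"] fi k e by simp
    show "exact_into C (Proj C) (?k \<cdot> ?e) ?g"
      using exact_into_Comp_epi [OF e(3)] f(1) k e by simp
    show "exact_from C (Proj C) (d (Suc 0)) (?k \<cdot> ?e)"
      using exact_from_Comp_mono [OF mono e(1)] D k by simp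
    show "exact_into C (Proj C) (d (Suc 0)) (?k \<cdot> ?e)"
      using exact_into_Comp_iff [OF e(3), of ?k Z "d (Suc 0)" "Proj C"] d_into [of 0] kZ k d1 e by simp
  qed
  have "exact_from C (Proj C) (\<delta> i) (\<delta> (i + 1)) \<and> exact_into C (Proj C) (\<delta> i) (\<delta> (i + 1))
      \<and> Dom C (\<delta> i) \<in> Proj C" for i
  proof -
    \<comment> \<open>Only the pairs starting in degrees -1 and -2 contain the composite; all others
      lie within \<open>f\<close> or within \<open>d\<close>.\<close>
    consider n where "i = int n" | "i = -1" | "i = -2" | n where "i = - 3 - int n"
    proof -
      have "i = int (nat i) \<or> i = -1 \<or> i = -2 \<or> i = - 3 - int (nat (- 3 - i))"
        by linarith
      then show ?thesis
        using that by blast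
    qed
    then show ?thesis
    proof cases
      case 1
      then have "\<delta> i = f (Suc (Suc n))" "\<delta> (i + 1) = f (Suc (Suc (Suc n)))"
        by (simp_all add: \<delta>_def nat_add_distrib)
      then show ?thesis
        using f(1,2) [of "Suc (Suc n)"] f(3) [of n] fi(2) [of "Suc n"] by simp
    next
      case 2
      then have "\<delta> i = ?k \<cdot> ?e" "\<delta> (i + 1) = ?g"
        by (simp_all add: \<delta>_def)
      then show ?thesis
        using splice k e D by simp
    next
      case 3
      then have "\<delta> i = d (Suc 0)" "\<delta> (i + 1) = ?k \<cdot> ?e"
        by (simp_all add: \<delta>_def)
      then show ?thesis
        using splice D by simp
    next
      case 4
      then have "\<delta> i = d (Suc (Suc n))" "\<delta> (i + 1) = d (Suc n)"
        by (simp_all add: \<delta>_def nat_add_distrib)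
      then show ?thesis
        using d_into [of "Suc n"] D by simp
    qed
  qed
  then have "totally_acyclic C (\<lambda>i. Dom C (\<delta> i)) \<delta>"
    by (simp add: totally_acyclic_iff)
  moreover have "\<delta> 0 = ?g"
    by (simp add: \<delta>_def)
  moreover have "isomorphic C M (Dom C ?k)"
    unfolding isomorphic_def using k by (intro conjI bexI [of _ "Ident C M"]) (auto simp: Hom_def)
  ultimately show ?thesis
    unfolding Gorenstein_projective_def using ker by metis
qed

lemma Gorenstein_projectiveE:
  assumes "Gorenstein_projective C M" and Z: "zero_object C Z" and M: "M \<in> Obj C"
  obtains Q d f where "projective_resolution C M Q d" "\<And>n. exact_into C (Proj C) (d (Suc n)) (d n)"
    and "f 0 = Zero C Z M" "\<And>i. exact_into C (Proj C) (f i) (f (Suc i))"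
      "\<And>i. exact_from C (Proj C) (f i) (f (Suc i))" "\<And>i. Cod C (f (Suc i)) \<in> Proj C"
proof -
  have [simp]: "Z \<in> Obj C" "M \<in> Obj C"
    using Z M by (auto simp: zero_object_def)
  obtain X \<delta> k0 where ta: "totally_acyclic C X \<delta>" and k0: "is_kernel C (\<delta> 0) k0"
    and iso: "isomorphic C M (Dom C k0)"
    using assms(1) by (auto simp: Gorenstein_projective_def)
  note T = ta [unfolded totally_acyclic_iff, rule_format]
  obtain u v where uv: "u \<in> Hom C M (Dom C k0)" "v \<in> Hom C (Dom C k0) M" "v \<cdot> u = Ident C M"
    "u \<cdot> v = Ident C (Dom C k0)"
    using iso by (auto simp: isomorphic_def)
  note K0 = kernelD(1-4) [OF k0]
  have [simp]: "u \<in> Arr C" "Dom C u = M" "Cod C u = Dom C k0" "v \<in> Arr C" "Dom C v = Dom C k0" "Cod C v = M"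
    "k0 \<in> Arr C" "Cod C k0 = Dom C (\<delta> 0)"
    using uv K0 by (auto simp: Hom_def)
  \<comment> \<open>The isomorphism is absorbed into the kernel, so that the complex is cut at
    \<open>M\<close> itself.\<close>
  define k where "k = k0 \<cdot> u"
  have k [simp]: "k \<in> Arr C" "Dom C k = M" "Cod C k = Dom C (\<delta> 0)"
    by (simp_all add: k_def)
  have "is_mono C u"
  proof (rule is_monoI_zero)
    fix W t assume t: "t \<in> Hom C W (Dom C u)" "u \<cdot> t = Zero C W (Cod C u)"
    then have [simp]: "t \<in> Arr C" "Dom C t = W" "Cod C t = M" "W \<in> Obj C"
      by (auto simp: Hom_def)
    have "v \<cdot> (u \<cdot> t) = t"
      using uv by (simp add: Comp_assoc_Arr [symmetric])
    then show "t = Zero C W (Dom C u)"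
      using t by simp
  qed simp
  then have mono: "is_mono C k"
    unfolding k_def by (intro is_mono_Comp kernel_mono [OF k0]) simp_all
  have dk: "\<delta> 0 \<cdot> k = Zero C M (Cod C (\<delta> 0))"
    using K0 by (simp add: k_def Comp_assoc_Arr [symmetric])
  have lift: "\<exists>h \<in> Hom C W M. k \<cdot> h = g"
    if g: "g \<in> Hom C W (Dom C (\<delta> 0))" "\<delta> 0 \<cdot> g = Zero C W (Cod C (\<delta> 0))" for g W
  proof -
    obtain w where w: "w \<in> Hom C W (Dom C k0)" "k0 \<cdot> w = g"
      using kernelD(5) [OF k0 g] by auto
    then have [simp]: "w \<in> Arr C" "Dom C w = W" "Cod C w = Dom C k0"
      by (auto simp: Hom_def)
    have "k \<cdot> (v \<cdot> w) = k0 \<cdot> ((u \<cdot> v) \<cdot> w)"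
      by (simp add: k_def Comp_assoc_Arr)
    also have "\<dots> = g"
      using uv w by simp
    finally show ?thesis
      by (intro bexI [of _ "v \<cdot> w"]) (auto simp: Hom_def)
  qed
  have dd: "\<delta> (- 1) \<in> Hom C (X (- 1)) (Dom C (\<delta> 0))" "\<delta> 0 \<cdot> \<delta> (- 1) = Zero C (X (- 1)) (Cod C (\<delta> 0))"
    using T [of "- 1"] by (auto simp: exact_from_def Hom_def)
  obtain e where e: "e \<in> Hom C (X (- 1)) M" "k \<cdot> e = \<delta> (- 1)"
    using lift [OF dd] by blast
  have [simp]: "e \<in> Arr C" "Dom C e = X (- 1)" "Cod C e = M"
    using e by (auto simp: Hom_def)
  \<comment> \<open>Exactness of the complex in degree 0 yields both that \<open>k\<close> is exact
    before \<delta> 0 and that \<open>e\<close> is epi.\<close>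
  have ex0: "exact_from C (Proj C) k (\<delta> 0)" "is_epi C e"
    using exact_from_Comp_iff [OF mono, of e Z "\<delta> 0" "Proj C"] exact_from_Zero_iff [of Z e] dk K0 T [of "- 1"] e(2)
    by simp_all
  have ex1: "exact_from C (Proj C) (\<delta> (- 2)) e"
    using exact_from_Comp_mono [OF mono, of e "Proj C" "\<delta> (- 2)"] T [of "- 2"] e(2) by simp
  \<comment> \<open>Hom(-, Q)-exactness in degree -1 splits likewise; the second half says that
    every arrow from \<open>M\<close> to a projective factors through \<open>k\<close>.\<close>
  have ex2: "exact_into C (Proj C) (\<delta> (- 2)) e" "exact_into C (Proj C) (Zero C Z M) k"
    using exact_into_Comp_iff [OF ex0(2), of k Z "\<delta> (- 2)" "Proj C"] T [of "- 2"] e(2) exact_fromD(1-4) [OF ex1]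
    by simp_all
  have ex3: "exact_into C (Proj C) k (\<delta> 0)"
    using exact_into_Comp_epi [OF ex0(2), of k "Proj C" "\<delta> 0"] T [of "- 1"] e(2) by simp
  define d where "d n = (if n = 0 then e else \<delta> (- 1 - int n))" for n
  have d: "exact_from C (Proj C) (d (Suc n)) (d n) \<and> exact_into C (Proj C) (d (Suc n)) (d n)
      \<and> Dom C (d n) \<in> Proj C" for n
  proof (cases n)
    case 0
    then show ?thesis
      using ex1 ex2 T by (simp add: d_def)
  next
    case (Suc m)
    have "- 1 - int (Suc n) + 1 = - 1 - int n"
      by simp
    then show ?thesis
      using Suc T [of "- 1 - int (Suc n)"] T [of "- 1 - int n"] by (simp add: d_def)
  qed
  have "projective_resolution C M (\<lambda>n. Dom C (d n)) d"
    unfolding projective_resolution_iff [OF Z M] using d ex0 by (simp add: d_def)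
  moreover define f where "f n = (case n of 0 \<Rightarrow> Zero C Z M | Suc 0 \<Rightarrow> k | Suc (Suc m) \<Rightarrow> \<delta> (int m))" for n
  have "exact_into C (Proj C) (f i) (f (Suc i)) \<and> exact_from C (Proj C) (f i) (f (Suc i))
      \<and> Cod C (f (Suc i)) \<in> Proj C" for i
  proof -
    consider "i = 0" | "i = 1" | m where "i = Suc (Suc m)"
      by (metis One_nat_def not0_implies_Suc)
    then show ?thesis
    proof cases
      case 1
      then show ?thesis
        using ex2 exact_from_Zero_left [of Z k] mono T by (simp add: f_def)
    next
      case 2
      then show ?thesis
        using ex3 ex0 T [of 0] T [of 1] by (simp add: f_def exact_from_def)
    next
      case 3
      have step: "exact_from C (Proj C) (\<delta> (int n)) (\<delta> (int (Suc n))) \<and>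
          exact_into C (Proj C) (\<delta> (int n)) (\<delta> (int (Suc n)))" for n
        using T [of "int n"] by (simp add: add.commute)
      have "Cod C (\<delta> (int (Suc m))) \<in> Proj C"
        using exact_fromD(3) [of "Proj C" "\<delta> (int (Suc m))"] step [of "Suc m"] T by metis
      then show ?thesis
        using 3 step [of m] by (simp add: f_def)
    qed
  qed
  moreover have "f 0 = Zero C Z M"
    by (simp add: f_def)
  ultimately show ?thesis
    using that d by blast
qed

lemma Gorenstein_projective_iff_perp_torsionfree:
  assumes M: "M \<in> Obj C"
  shows "Gorenstein_projective C M \<longleftrightarrow> M \<in> perp_Proj C \<inter> infinitely_torsionfree C"
proof -
  obtain Z where Z: "zero_object C Z"
    using zero_object_exists by blast
  obtain Q d where d: "projective_resolution C M Q d"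
    using projective_resolution_exists [OF M] by blast
  \<comment> \<open>Needed for every resolution: one direction applies it to the resolution cut out
    of the totally acyclic complex, the other to an arbitrary one.\<close>
  have perp: "M \<in> perp_Proj C \<longleftrightarrow> (\<forall>n. exact_into C (Proj C) (d (Suc n)) (d n))"
    if "projective_resolution C M Q d" for Q d
    using Ext_trivial_iff [OF that M] M by (simp add: perp_Proj_def)
  show ?thesis
  proof
    assume "Gorenstein_projective C M"
    then show "M \<in> perp_Proj C \<inter> infinitely_torsionfree C"
      using perp by (auto elim!: Gorenstein_projectiveE [OF _ Z M] simp: infinitely_torsionfree_iff [OF Z M])
  next
    assume "M \<in> perp_Proj C \<inter> infinitely_torsionfree C"
    then show "Gorenstein_projective C M"
      using perp [OF d] Gorenstein_projectiveI [OF Z M d] by (auto simp: infinitely_torsionfree_iff [OF Z M])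
  qed
qed

end

theorem proposition2p8:
  fixes C :: "('o, 'm, 'z) preadditive_category_scheme"
  assumes "abelian_category_enough_projectives C"
  shows "(\<forall>M \<in> Obj C. Gorenstein_projective C M \<longleftrightarrow> G_dimension_zero C M)
       \<and> GP C = perp_Proj C \<inter> infinitely_torsionfree C"
proof -
  interpret abelian_category_enough_projectives C
    by (rule assms)
  have "G_dimension_zero C M \<longleftrightarrow> M \<in> perp_Proj C \<inter> infinitely_torsionfree C" for M
    by (auto simp: G_dimension_zero_def perp_Proj_def Suc_le_eq)
  then show ?thesis
    using Gorenstein_projective_iff_perp_torsionfree by (auto simp: GP_def perp_Proj_def)
qed

end
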